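(* Let $G$ be a finite group, $\pi:G\to\mathcal U(H_\pi)$ and $\rho:G\to\mathcal U(H_\rho)$ irreducible unitary representations, and $\psi\in H_\pi\otimes H_\rho$ a marginally cyclic unit vector such that $$\mathrm{span}\{(\pi(s)\otimes\rho(t))\psi\psi^*(\pi(s)\otimes\rho(t))^*:s,t\in G\}=\mathcal B(H_\pi\otimes H_\rho).$$ Let $u(s,t)=\langle(\pi(s)\otimes\rho(t))\psi,\psi\rangle$, $\tilde E_{s,s',g,g'}=\delta_{s,g}\delta_{s',g'}\pi(s^{-1}s')$ and $\tilde F_{t,t',h,h'}=\delta_{t,h}\delta_{t',h'}\rho(t^{-1}t')$. Then the model $(H_\pi\otimes H_\rho,\tilde E,\tilde F,\psi)$ is a self-test for the class $\mathfrak M(u)$: for every full rank unitary model $(H_A\otimes H_B,E,F,\xi)$ whose QNS correlation equals $\Theta(u)$, there exist Hilbert spaces $H_A^{\rm aux},H_B^{\rm aux}$, isometries $T_A:H_A\to H_\pi\otimes H_A^{\rm aux}$, $T_B:H_B\to H_\rho\otimes H_B^{\rm aux}$ and a unit vector $\xi^{\rm aux}\in H_A^{\rm aux}\otimes H_B^{\rm aux}$ such that $$(T_A\otimes T_B)(E_{s,s',g,g'}\otimes F_{t,t',h,h'})\xi=\big((\tilde E_{s,s',g,g'}\otimes\tilde F_{t,t',h,h'})\psi\big)\otimes\xi^{\rm aux}$$ for all $s,s',g,g',t,t',h,h'\in G$ (with the obvious reshuffling of tensor factors).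
   Context: Vectors $\psi\in H\otimes K$ (finite dimensional) are marginally cyclic if $(\mathcal B(H)\otimes1)\psi=H\otimes K=(1\otimes\mathcal B(K))\psi$ (equivalently, $\psi$ has full Schmidt rank). For a finite set $G$, $e_{s,s'}$ are the matrix units of $\mathcal B(\ell^2(G))$, and the Schur multiplier channel $\Theta(u)$ on $\mathcal B(\ell^2(G))\otimes\mathcal B(\ell^2(G))$ is given by $\Theta(u)(e_{s,s'}\otimes e_{t,t'})=u(s^{-1}s',t^{-1}t')e_{s,s'}\otimes e_{t,t'}$. A unistochastic operator matrix (USOM) over $G$ on a Hilbert space $H$ is a block operator matrix $(E_{s,s',g,g'})_{s,s',g,g'\in G}$ with $E_{s,s',g,g'}=U_{g,s}^*U_{g',s'}$ for some block unitary $U=(U_{g,s})$ on $H^G=\oplus_{g\in G}H$. A unitary model is $(H_A\otimes H_B,E,F,\xi)$ with $H_A,H_B$ finite dimensional, $E$ a USOM on $H_A$, $F$ a USOM on $H_B$, $\xi$ a unit vector; it is full rank if the reduced density operators $(\mathrm{id}\otimes\mathrm{Tr})(\xi\xi^* )$ and $(\mathrm{Tr}\otimes\mathrm{id})(\xi\xi^* )$ are invertible. Its QNS correlation is the map $\Gamma$ with $\Gamma(e_{s,s'}\otimes e_{t,t'})=\sum_{g,g',h,h'}\langle(E_{s,s',g,g'}\otimes F_{t,t',h,h'})\xi,\xi\rangle e_{g,g'}\otimes e_{h,h'}$. *)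

theory Defs
  imports "Jordan_Normal_Form.Schur_Decomposition" "HOL-Algebra.Group"
begin

text \<open>Finite-dimensional Hilbert spaces are modelled as C^d = carrier_vec d,
operators as complex matrices (carrier_mat d d). The tensor product C^m (x) C^n is
C^(m*n) with the standard Kronecker index convention (i,j) |-> i*n + j.\<close>

definition kron_mat :: "complex mat \<Rightarrow> complex mat \<Rightarrow> complex mat" where
  "kron_mat A B = mat (dim_row A * dim_row B) (dim_col A * dim_col B)
     (\<lambda>(i,j). A $$ (i div dim_row B, j div dim_col B) * B $$ (i mod dim_row B, j mod dim_col B))"

definition kron_vec :: "complex vec \<Rightarrow> complex vec \<Rightarrow> complex vec" where
  "kron_vec v w = vec (dim_vec v * dim_vec w) (\<lambda>i. v $ (i div dim_vec w) * w $ (i mod dim_vec w))"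

text \<open>Inner product <x,y> = x \<bullet>c y = sum_i x_i * cnj(y_i).\<close>

definition unit_vec_in :: "nat \<Rightarrow> complex vec \<Rightarrow> bool" where
  "unit_vec_in n v \<longleftrightarrow> v \<in> carrier_vec n \<and> v \<bullet>c v = 1"

definition unitary_in :: "nat \<Rightarrow> complex mat \<Rightarrow> bool" where
  "unitary_in d A \<longleftrightarrow> A \<in> carrier_mat d d \<and> mat_adjoint A * A = 1\<^sub>m d \<and> A * mat_adjoint A = 1\<^sub>m d"

definition isometry_mat :: "nat \<Rightarrow> nat \<Rightarrow> complex mat \<Rightarrow> bool" where
  "isometry_mat m n T \<longleftrightarrow> T \<in> carrier_mat m n \<and> mat_adjoint T * T = 1\<^sub>m n"

definition msum :: "nat \<Rightarrow> 'i set \<Rightarrow> ('i \<Rightarrow> complex mat) \<Rightarrow> complex mat" where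
  "msum d I f = mat d d (\<lambda>(i,j). \<Sum>k\<in>I. f k $$ (i,j))"

definition unitary_rep :: "('g,'b) monoid_scheme \<Rightarrow> nat \<Rightarrow> ('g \<Rightarrow> complex mat) \<Rightarrow> bool" where
  "unitary_rep G d repr \<longleftrightarrow> (\<forall>s\<in>carrier G. unitary_in d (repr s)) \<and>
     (\<forall>s\<in>carrier G. \<forall>t\<in>carrier G. repr (s \<otimes>\<^bsub>G\<^esub> t) = repr s * repr t)"

definition is_subspace :: "nat \<Rightarrow> complex vec set \<Rightarrow> bool" where
  "is_subspace d W \<longleftrightarrow> W \<subseteq> carrier_vec d \<and> 0\<^sub>v d \<in> W \<and>
     (\<forall>v\<in>W. \<forall>w\<in>W. v + w \<in> W) \<and> (\<forall>c. \<forall>v\<in>W. c \<cdot>\<^sub>v v \<in> W)"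

definition irreducible_rep :: "('g,'b) monoid_scheme \<Rightarrow> nat \<Rightarrow> ('g \<Rightarrow> complex mat) \<Rightarrow> bool" where
  "irreducible_rep G d repr \<longleftrightarrow> d > 0 \<and>
     (\<forall>W. is_subspace d W \<and> (\<forall>s\<in>carrier G. \<forall>w\<in>W. repr s *\<^sub>v w \<in> W)
          \<longrightarrow> W = {0\<^sub>v d} \<or> W = carrier_vec d)"

definition marginally_cyclic :: "nat \<Rightarrow> nat \<Rightarrow> complex vec \<Rightarrow> bool" where
  "marginally_cyclic m n psi \<longleftrightarrow> psi \<in> carrier_vec (m*n) \<and>
     {kron_mat A (1\<^sub>m n) *\<^sub>v psi | A. A \<in> carrier_mat m m} = carrier_vec (m*n) \<and>
     {kron_mat (1\<^sub>m m) B *\<^sub>v psi | B. B \<in> carrier_mat n n} = carrier_vec (m*n)"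

definition mat_span :: "nat \<Rightarrow> 'i set \<Rightarrow> ('i \<Rightarrow> complex mat) \<Rightarrow> complex mat set" where
  "mat_span d I f = {msum d I (\<lambda>k. c k \<cdot>\<^sub>m f k) | c. True}"

definition outer :: "complex vec \<Rightarrow> complex mat" where
  "outer v = mat (dim_vec v) (dim_vec v) (\<lambda>(i,j). v $ i * cnj (v $ j))"

definition ptrace_2 :: "nat \<Rightarrow> nat \<Rightarrow> complex mat \<Rightarrow> complex mat" where
  "ptrace_2 m n M = mat m m (\<lambda>(i,i'). \<Sum>j<n. M $$ (i*n+j, i'*n+j))"

definition ptrace_1 :: "nat \<Rightarrow> nat \<Rightarrow> complex mat \<Rightarrow> complex mat" where
  "ptrace_1 m n M = mat n n (\<lambda>(j,j'). \<Sum>i<m. M $$ (i*n+j, i*n+j'))"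

text \<open>Unistochastic operator matrix over G on C^d: E s s' g g' = U_{g,s}^* U_{g',s'}
  for a block unitary U = (U_{g,s}) on the direct sum of |G| copies of C^d
  (block unitarity U^*U = 1 = UU^* written out blockwise).\<close>
definition usom :: "('g,'b) monoid_scheme \<Rightarrow> nat \<Rightarrow> ('g \<Rightarrow> 'g \<Rightarrow> 'g \<Rightarrow> 'g \<Rightarrow> complex mat) \<Rightarrow> bool" where
  "usom G d E \<longleftrightarrow> (\<exists>U :: 'g \<Rightarrow> 'g \<Rightarrow> complex mat.
     (\<forall>g\<in>carrier G. \<forall>s\<in>carrier G. U g s \<in> carrier_mat d d) \<and>
     (\<forall>s\<in>carrier G. \<forall>s'\<in>carrier G.
        msum d (carrier G) (\<lambda>g. mat_adjoint (U g s) * U g s') = (if s = s' then 1\<^sub>m d else 0\<^sub>m d d)) \<and>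
     (\<forall>g\<in>carrier G. \<forall>g'\<in>carrier G.
        msum d (carrier G) (\<lambda>s. U g s * mat_adjoint (U g' s)) = (if g = g' then 1\<^sub>m d else 0\<^sub>m d d)) \<and>
     (\<forall>s\<in>carrier G. \<forall>s'\<in>carrier G. \<forall>g\<in>carrier G. \<forall>g'\<in>carrier G.
        E s s' g g' = mat_adjoint (U g s) * U g' s'))"

definition unitary_model :: "('g,'b) monoid_scheme \<Rightarrow> nat \<Rightarrow> nat \<Rightarrow> ('g \<Rightarrow> 'g \<Rightarrow> 'g \<Rightarrow> 'g \<Rightarrow> complex mat)
    \<Rightarrow> ('g \<Rightarrow> 'g \<Rightarrow> 'g \<Rightarrow> 'g \<Rightarrow> complex mat) \<Rightarrow> complex vec \<Rightarrow> bool" where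
  "unitary_model G dA dB E F xi \<longleftrightarrow> usom G dA E \<and> usom G dB F \<and> unit_vec_in (dA*dB) xi"

definition full_rank_model :: "('g,'b) monoid_scheme \<Rightarrow> nat \<Rightarrow> nat \<Rightarrow> ('g \<Rightarrow> 'g \<Rightarrow> 'g \<Rightarrow> 'g \<Rightarrow> complex mat)
    \<Rightarrow> ('g \<Rightarrow> 'g \<Rightarrow> 'g \<Rightarrow> 'g \<Rightarrow> complex mat) \<Rightarrow> complex vec \<Rightarrow> bool" where
  "full_rank_model G dA dB E F xi \<longleftrightarrow> unitary_model G dA dB E F xi \<and>
     invertible_mat (ptrace_2 dA dB (outer xi)) \<and> invertible_mat (ptrace_1 dA dB (outer xi))"

text \<open>Elements of B(l^2(G) (x) l^2(G)) are represented by their matrix entries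
  X (s,t) (s',t') w.r.t. the basis e_s (x) e_t; so e_{s,s'} (x) e_{t,t'} is the matrix
  unit at ((s,t),(s',t')).\<close>
type_synonym 'g gop = "'g \<times> 'g \<Rightarrow> 'g \<times> 'g \<Rightarrow> complex"

text \<open>QNS correlation of a unitary model, extended linearly from matrix units.\<close>
definition qns_corr :: "('g,'b) monoid_scheme \<Rightarrow> ('g \<Rightarrow> 'g \<Rightarrow> 'g \<Rightarrow> 'g \<Rightarrow> complex mat)
    \<Rightarrow> ('g \<Rightarrow> 'g \<Rightarrow> 'g \<Rightarrow> 'g \<Rightarrow> complex mat) \<Rightarrow> complex vec \<Rightarrow> 'g gop \<Rightarrow> 'g gop" where
  "qns_corr G E F xi X = (\<lambda>(g,h) (g',h').
     \<Sum>s\<in>carrier G. \<Sum>s'\<in>carrier G. \<Sum>t\<in>carrier G. \<Sum>t'\<in>carrier G.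
       X (s,t) (s',t') * ((kron_mat (E s s' g g') (F t t' h h') *\<^sub>v xi) \<bullet>c xi))"

definition schur_channel :: "('g,'b) monoid_scheme \<Rightarrow> ('g \<Rightarrow> 'g \<Rightarrow> complex) \<Rightarrow> 'g gop \<Rightarrow> 'g gop" where
  "schur_channel G u X = (\<lambda>(s,t) (s',t').
     u (inv\<^bsub>G\<^esub> s \<otimes>\<^bsub>G\<^esub> s') (inv\<^bsub>G\<^esub> t \<otimes>\<^bsub>G\<^esub> t') * X (s,t) (s',t'))"

definition gchannel_eq :: "('g,'b) monoid_scheme \<Rightarrow> ('g gop \<Rightarrow> 'g gop) \<Rightarrow> ('g gop \<Rightarrow> 'g gop) \<Rightarrow> bool" where
  "gchannel_eq G \<Phi> \<Psi> \<longleftrightarrow> (\<forall>X. \<forall>a\<in>carrier G \<times> carrier G. \<forall>b\<in>carrier G \<times> carrier G. \<Phi> X a b = \<Psi> X a b)"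

text \<open>Reshuffling (H_p (x) H_r) (x) (K_a (x) K_b) -> (H_p (x) K_a) (x) (H_r (x) K_b).\<close>
definition reshuffle :: "nat \<Rightarrow> nat \<Rightarrow> nat \<Rightarrow> nat \<Rightarrow> complex vec \<Rightarrow> complex vec" where
  "reshuffle p r a b v = vec ((p*a)*(r*b)) (\<lambda>i.
     let x = i div (r*b); y = i mod (r*b) in
     v $ (((x div a)*r + y div b)*(a*b) + ((x mod a)*b + y mod b)))"

definition rep_usom :: "('g,'b) monoid_scheme \<Rightarrow> nat \<Rightarrow> ('g \<Rightarrow> complex mat) \<Rightarrow> 'g \<Rightarrow> 'g \<Rightarrow> 'g \<Rightarrow> 'g \<Rightarrow> complex mat" where
  "rep_usom G d repr s s' g g' = (if g = s \<and> g' = s' then repr (inv\<^bsub>G\<^esub> s \<otimes>\<^bsub>G\<^esub> s') else 0\<^sub>m d d)"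

end

(* A full rank model with correlation Theta(u) has block diagonal U, V: the diagonal entries of the
   correlation force (U_gs (x) 1) xi = 0 for g distinct from s. Normalising the blocks gives unitaries A_s, B_t
   with A_1 = B_1 = 1, and the remaining entries say that the vectors (A_s (x) B_t) xi have the same
   Gram matrix as (pi(s) (x) rho(t)) psi. By Schur orthogonality the latter form a tight frame, so
   there is an isometry W with W (pi(s) (x) rho(t)) psi = (A_s (x) B_t) xi, in particular W psi = xi.
   As psi is marginally cyclic, (A_s (x) 1) W = W (pi(s) (x) 1) and (1 (x) B_t) W = W (1 (x) rho(t)).
   The combinations P_i = (dim pi / |G|) sum_s conj(pi_0i(s)) A_s therefore satisfy
   (P_i (x) 1) W = W (e_0i (x) 1), and T_A v = sum_i e_i (x) P_i v is an isometry because xi has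
   full rank; similarly T_B. Finally (T_A (x) T_B) W eta = eta (x) W(e_0 (x) e_0) for all eta. *)

theory Submission
  imports Defs "Jordan_Normal_Form.Spectral_Radius"
begin

section \<open>Adjoints, Kronecker products and sums of matrices\<close>

text \<open>The operators of the unknown model come with no group structure: nothing says that s
  \<mapsto> A_s is multiplicative, and the correlation controls inner products only. Every algebraic
  relation is therefore read off through the isometry W, in the form K W = W L. Such relations are
  stable under products, linear combinations and, for unitaries, adjoints, which is enough to carry
  the matrix units of B(H_\<pi>) and B(H_\<rho>) over. The range of W may be a proper subspace of
  H_A \<otimes> H_B, so an intertwining relation alone does not determine an operator; evaluated at
  \<xi> = W\<psi> it does, since (M \<otimes> 1)\<xi> = 0 forces M = 0 when the reduced density is
  invertible. The factor dim \<pi>/|G| inverts the constant of Schur orthogonality. Row 0 is a fixed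
  reference direction: e_0i \<otimes> e_0j moves the coordinate (i,j) of a vector to the place
  (0,0), so the coordinates end up in the new tensor factor and what remains is always the same
  vector.\<close>

lemma mat_adjoint_carrier [simp]:
  "A \<in> carrier_mat m n \<Longrightarrow> mat_adjoint A \<in> carrier_mat n m"
  unfolding mat_adjoint_def by auto
lemma mat_adjoint_dim [simp]:
  "dim_row (mat_adjoint A) = dim_col A" "dim_col (mat_adjoint A) = dim_row A"
  unfolding mat_adjoint_def by simp_all
lemma mat_adjoint_index [simp]:
  fixes A :: "complex mat"
  assumes "i < dim_col A" "j < dim_row A"
  shows "mat_adjoint A $$ (i,j) = cnj (A $$ (j,i))"
proof -
  have "mat_adjoint A $$ (i,j) = (map conjugate (cols A) ! i) $ j"
    unfolding mat_adjoint_def using assms by (intro mat_of_rows_index) auto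
  then show ?thesis using assms by simp
qed

lemma mat_adjoint_adjoint [simp]: "mat_adjoint (mat_adjoint A) = (A :: complex mat)"
  by (rule eq_matI) auto

lemma mat_adjoint_mult:
  fixes A B :: "complex mat"
  assumes "A \<in> carrier_mat m n" "B \<in> carrier_mat n k"
  shows "mat_adjoint (A * B) = mat_adjoint B * mat_adjoint A"
  using assms by (intro eq_matI) (auto simp: scalar_prod_def mult.commute)

lemma mat_adjoint_one [simp]: "mat_adjoint (1\<^sub>m n) = (1\<^sub>m n :: complex mat)"
  by (rule eq_matI) auto

lemma mat_adjoint_smult: "mat_adjoint (c \<cdot>\<^sub>m A) = cnj c \<cdot>\<^sub>m mat_adjoint (A :: complex mat)"
  by (rule eq_matI) auto

lemma cscalar_mult_mat_vec:
  fixes A :: "complex mat"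
  assumes "A \<in> carrier_mat m n" "v \<in> carrier_vec n" "w \<in> carrier_vec m"
  shows "(A *\<^sub>v v) \<bullet>c w = v \<bullet>c (mat_adjoint A *\<^sub>v w)"
proof -
  have "(A *\<^sub>v v) \<bullet>c w = (\<Sum>i<m. \<Sum>j<n. A $$ (i,j) * v $ j * cnj (w $ i))"
    using assms by (simp add: scalar_prod_def sum_distrib_right atLeast0LessThan)
  also have "\<dots> = (\<Sum>j<n. \<Sum>i<m. A $$ (i,j) * v $ j * cnj (w $ i))"
    by (rule sum.swap)
  also have "\<dots> = v \<bullet>c (mat_adjoint A *\<^sub>v w)"
    using assms by (simp add: scalar_prod_def sum_distrib_left atLeast0LessThan mult_ac)
  finally show ?thesis .
qed

lemma mat_eqI_mult_vec:
  fixes A :: "complex mat"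
  assumes "A \<in> carrier_mat m n" "B \<in> carrier_mat m n"
    and "\<And>v. v \<in> carrier_vec n \<Longrightarrow> A *\<^sub>v v = B *\<^sub>v v"
  shows "A = B"
proof (rule eq_matI)
  fix i j assume ij: "i < dim_row B" "j < dim_col B"
  have "(A *\<^sub>v unit_vec n j) $ i = (B *\<^sub>v unit_vec n j) $ i" using assms(3) by simp
  then show "A $$ (i,j) = B $$ (i,j)" using assms(1,2) ij by simp
qed (use assms in auto)

section \<open>Pair indices i*n+j and entrywise calculus of Kronecker products\<close>

lemma sum_lessThan_mult:
  fixes f :: "nat \<Rightarrow> 'a :: comm_monoid_add"
  shows "(\<Sum>k<m*n. f k) = (\<Sum>i<m. \<Sum>j<n. f (i*n+j))"
proof -
  have "(\<Sum>j<n. f (i*n+j)) = sum f {i*n..<i*n+n}" for i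
    using sum.shift_bounds_nat_ivl[of f 0 "i*n" n] by (simp add: atLeast0LessThan add.commute)
  then have "(\<Sum>i<m. \<Sum>j<n. f (i*n+j)) = (\<Sum>i<m. sum f {i*n..<i*n+n})" by simp
  also have "\<dots> = (\<Sum>k<m*n. f k)" by (rule sum.nat_group)
  finally show ?thesis by simp
qed

lemma pair_index_less:
  assumes "i < m" "j < (n::nat)" shows "i*n+j < m*n"
proof -
  have "i*n+j < (i+1)*n" using assms by simp
  also have "\<dots> \<le> m*n" using assms by (intro mult_right_mono) auto
  finally show ?thesis .
qed

lemma pair_index_div [simp]: "j < (n::nat) \<Longrightarrow> (i*n+j) div n = i"
  and pair_index_mod [simp]: "j < (n::nat) \<Longrightarrow> (i*n+j) mod n = j"
  by auto

lemma pair_index_cases: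
  assumes "(k::nat) < m*n"
  obtains i j where "i < m" "j < n" "k = i*n+j"
proof
  show "k div n < m" using assms by (simp add: less_mult_imp_div_less)
  have "n > 0" using assms by (cases n) auto
  then show "k mod n < n" by simp
qed simp

lemma kron_mat_dim [simp]:
  "dim_row (kron_mat A B) = dim_row A * dim_row B"
  "dim_col (kron_mat A B) = dim_col A * dim_col B"
  unfolding kron_mat_def by simp_all

lemma kron_mat_carrier [simp]:
  "A \<in> carrier_mat m n \<Longrightarrow> B \<in> carrier_mat m' n' \<Longrightarrow> kron_mat A B \<in> carrier_mat (m*m') (n*n')"
  by (rule carrier_matI) simp_all

lemma kron_mat_index:
  assumes "A \<in> carrier_mat m n" "B \<in> carrier_mat m' n'" "i < m" "j < m'" "k < n" "l < n'"
  shows "kron_mat A B $$ (i*m'+j, k*n'+l) = A $$ (i,k) * B $$ (j,l)"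
  using assms unfolding kron_mat_def by (simp add: pair_index_less)

lemma eq_mat_pairI:
  assumes "A \<in> carrier_mat (m*m') (n*n')" "B \<in> carrier_mat (m*m') (n*n')"
    and "\<And>i j k l. i < m \<Longrightarrow> j < m' \<Longrightarrow> k < n \<Longrightarrow> l < n' \<Longrightarrow>
      A $$ (i*m'+j, k*n'+l) = B $$ (i*m'+j, k*n'+l)"
  shows "A = B"
proof (rule eq_matI)
  fix x y assume "x < dim_row B" "y < dim_col B"
  with assms(2) have "x < m*m'" "y < n*n'" by auto
  then obtain i j k l where "i < m" "j < m'" "x = i*m'+j" "k < n" "l < n'" "y = k*n'+l"
    by (metis pair_index_cases)
  then show "A $$ (x,y) = B $$ (x,y)" using assms(3) by simp
qed (use assms in auto)

lemma eq_vec_pairI: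
  assumes "v \<in> carrier_vec (m*n)" "w \<in> carrier_vec (m*n)"
    and "\<And>i j. i < m \<Longrightarrow> j < n \<Longrightarrow> v $ (i*n+j) = w $ (i*n+j)"
  shows "v = w"
proof (rule eq_vecI)
  fix x assume "x < dim_vec w"
  with assms(2) have "x < m*n" by auto
  then obtain i j where "i < m" "j < n" "x = i*n+j" by (metis pair_index_cases)
  then show "v $ x = w $ x" using assms(3) by simp
qed (use assms in auto)

lemma kron_mat_mult_vec_index:
  assumes "A \<in> carrier_mat m n" "B \<in> carrier_mat m' n'" "v \<in> carrier_vec (n*n')" "i < m" "j < m'"
  shows "(kron_mat A B *\<^sub>v v) $ (i*m'+j) = (\<Sum>k<n. \<Sum>l<n'. A $$ (i,k) * B $$ (j,l) * v $ (k*n'+l))"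
proof -
  have "(kron_mat A B *\<^sub>v v) $ (i*m'+j) = (\<Sum>k<n*n'. kron_mat A B $$ (i*m'+j, k) * v $ k)"
    using assms pair_index_less[of i m j m']
    by (simp add: scalar_prod_def atLeast0LessThan)
  then show ?thesis using assms by (simp add: sum_lessThan_mult kron_mat_index)
qed

lemma kron_mat_mult:
  assumes "A \<in> carrier_mat m n" "B \<in> carrier_mat m' n'" "C \<in> carrier_mat n k" "D \<in> carrier_mat n' k'"
  shows "kron_mat A B * kron_mat C D = kron_mat (A * C) (B * D)"
proof (rule eq_mat_pairI[of _ m m' k k'])
  fix a b c d assume i: "a < m" "b < m'" "c < k" "d < k'"
  have "(kron_mat A B * kron_mat C D) $$ (a*m'+b, c*k'+d)
      = (\<Sum>j<n*n'. kron_mat A B $$ (a*m'+b, j) * kron_mat C D $$ (j, c*k'+d))"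
    using assms i pair_index_less[of a m b m'] pair_index_less[of c k d k']
    by (simp add: scalar_prod_def atLeast0LessThan)
  also have "\<dots> = (\<Sum>x<n. \<Sum>y<n'. (A $$ (a,x) * C $$ (x,c)) * (B $$ (b,y) * D $$ (y,d)))"
    using assms i by (simp add: sum_lessThan_mult kron_mat_index mult_ac)
  also have "\<dots> = (A * C) $$ (a,c) * (B * D) $$ (b,d)"
    using assms i by (simp add: scalar_prod_def atLeast0LessThan sum_product)
  also have "\<dots> = kron_mat (A * C) (B * D) $$ (a*m'+b, c*k'+d)"
    using assms i by (subst kron_mat_index[of _ m k _ m' k']) auto
  finally show "(kron_mat A B * kron_mat C D) $$ (a*m'+b, c*k'+d)
      = kron_mat (A * C) (B * D) $$ (a*m'+b, c*k'+d)" .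
qed (use assms in \<open>auto intro!: mult_carrier_mat kron_mat_carrier\<close>)

lemma mat_adjoint_kron: "mat_adjoint (kron_mat A B) = kron_mat (mat_adjoint A) (mat_adjoint B)"
proof -
  obtain m n m' n' where c: "A \<in> carrier_mat m n" "B \<in> carrier_mat m' n'" by blast
  show ?thesis
    by (rule eq_mat_pairI[of _ n n' m m'])
      (use c in \<open>simp_all add: pair_index_less kron_mat_index[of _ m n _ m' n'] kron_mat_index[of _ n m _ n' m']\<close>)
qed

lemma mod_less_mult: "(k::nat) < m*n \<Longrightarrow> k mod n < n"
  by (cases n) auto

lemma kron_mat_one [simp]: "kron_mat (1\<^sub>m m) (1\<^sub>m n) = 1\<^sub>m (m*n)"
proof (rule eq_mat_pairI[of _ m n m n])
  fix i j k l assume i: "i < m" "j < n" "k < m" "l < n"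
  then have "i*n+j = k*n+l \<longleftrightarrow> i = k \<and> j = l"
    by (metis pair_index_div pair_index_mod)
  with i show "kron_mat (1\<^sub>m m) (1\<^sub>m n) $$ (i*n+j, k*n+l) = 1\<^sub>m (m*n) $$ (i*n+j, k*n+l)"
    by (auto simp: pair_index_less kron_mat_index[of _ m m _ n n])
qed auto

lemma kron_mat_zero_left [simp]: "kron_mat (0\<^sub>m m n) B = 0\<^sub>m (m * dim_row B) (n * dim_col B)"
  unfolding kron_mat_def by (intro eq_matI) (auto simp: less_mult_imp_div_less)

lemma kron_mat_zero_right [simp]: "kron_mat A (0\<^sub>m m n) = 0\<^sub>m (dim_row A * m) (dim_col A * n)"
  unfolding kron_mat_def by (intro eq_matI) (auto simp: mod_less_mult)

lemma kron_mat_smult_left: "kron_mat (c \<cdot>\<^sub>m A) B = c \<cdot>\<^sub>m kron_mat A B"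
  and kron_mat_smult_right: "kron_mat A (c \<cdot>\<^sub>m B) = c \<cdot>\<^sub>m kron_mat A B"
  unfolding kron_mat_def by (intro eq_matI; simp add: less_mult_imp_div_less mod_less_mult)+

section \<open>Finite sums of matrices and their compatibility with products, adjoints and Kronecker
  products\<close>

lemma mult_mat_index:
  fixes A B :: "complex mat"
  assumes "A \<in> carrier_mat m n" "B \<in> carrier_mat n k" "i < m" "j < k"
  shows "(A * B) $$ (i,j) = (\<Sum>x<n. A $$ (i,x) * B $$ (x,j))"
  using assms by (simp add: scalar_prod_def atLeast0LessThan)

text \<open>The rectangular form of \<open>msum\<close>: multiplying a sum of square matrices by the
  isometry \<open>W\<close> leaves the square case. Fixing the shape beforehand gives the empty sum
  a definite size.\<close>

definition mat_sum :: "nat \<Rightarrow> nat \<Rightarrow> 'i set \<Rightarrow> ('i \<Rightarrow> complex mat) \<Rightarrow> complex mat" where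
  "mat_sum m n I f = mat m n (\<lambda>(i,j). \<Sum>k\<in>I. f k $$ (i,j))"

lemma mat_sum_carrier [simp]: "mat_sum m n I f \<in> carrier_mat m n"
  and mat_sum_dim [simp]: "dim_row (mat_sum m n I f) = m" "dim_col (mat_sum m n I f) = n"
  and mat_sum_index [simp]: "i < m \<Longrightarrow> j < n \<Longrightarrow> mat_sum m n I f $$ (i,j) = (\<Sum>k\<in>I. f k $$ (i,j))"
  unfolding mat_sum_def by auto

lemma msum_eq_mat_sum: "msum d = mat_sum d d"
  by (intro ext) (simp add: msum_def mat_sum_def)

lemma mat_sum_cong:
  "(\<And>k. k \<in> I \<Longrightarrow> f k = g k) \<Longrightarrow> mat_sum m n I f = mat_sum m n I g"
  unfolding mat_sum_def by simp

lemma mult_mat_sum: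
  assumes "A \<in> carrier_mat l m" "\<And>k. k \<in> I \<Longrightarrow> f k \<in> carrier_mat m n"
  shows "A * mat_sum m n I f = mat_sum l n I (\<lambda>k. A * f k)"
proof (rule eq_matI)
  fix i j assume ij: "i < dim_row (mat_sum l n I (\<lambda>k. A * f k))" "j < dim_col (mat_sum l n I (\<lambda>k. A * f k))"
  have "(A * mat_sum m n I f) $$ (i,j) = (\<Sum>x<m. \<Sum>k\<in>I. A $$ (i,x) * f k $$ (x,j))"
    using assms(1) ij by (simp add: scalar_prod_def atLeast0LessThan sum_distrib_left)
  also have "\<dots> = (\<Sum>k\<in>I. \<Sum>x<m. A $$ (i,x) * f k $$ (x,j))" by (rule sum.swap)
  also have "\<dots> = (\<Sum>k\<in>I. (A * f k) $$ (i,j))"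
    using assms ij by (intro sum.cong refl) (simp add: mult_mat_index[of A l m _ n])
  finally show "(A * mat_sum m n I f) $$ (i,j) = mat_sum l n I (\<lambda>k. A * f k) $$ (i,j)" using ij by simp
qed (use assms in auto)

lemma mat_adjoint_mat_sum:
  assumes "\<And>k. k \<in> I \<Longrightarrow> f k \<in> carrier_mat m n"
  shows "mat_adjoint (mat_sum m n I f) = mat_sum n m I (\<lambda>k. mat_adjoint (f k))"
proof (rule eq_matI)
  fix i j assume "i < dim_row (mat_sum n m I (\<lambda>k. mat_adjoint (f k)))" "j < dim_col (mat_sum n m I (\<lambda>k. mat_adjoint (f k)))"
  moreover from this have "k \<in> I \<Longrightarrow> cnj (f k $$ (j,i)) = mat_adjoint (f k) $$ (i,j)" for k
    using assms[of k] by auto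
  ultimately show "mat_adjoint (mat_sum m n I f) $$ (i,j) = mat_sum n m I (\<lambda>k. mat_adjoint (f k)) $$ (i,j)"
    by simp
qed auto

lemma mat_sum_mult:
  assumes "A \<in> carrier_mat n l" "\<And>k. k \<in> I \<Longrightarrow> f k \<in> carrier_mat m n"
  shows "mat_sum m n I f * A = mat_sum m l I (\<lambda>k. f k * A)"
proof (rule eq_matI)
  fix i j assume ij: "i < dim_row (mat_sum m l I (\<lambda>k. f k * A))" "j < dim_col (mat_sum m l I (\<lambda>k. f k * A))"
  have "(mat_sum m n I f * A) $$ (i,j) = (\<Sum>x<n. \<Sum>k\<in>I. f k $$ (i,x) * A $$ (x,j))"
    using assms(1) ij by (simp add: scalar_prod_def atLeast0LessThan sum_distrib_right)
  also have "\<dots> = (\<Sum>k\<in>I. \<Sum>x<n. f k $$ (i,x) * A $$ (x,j))" by (rule sum.swap)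
  also have "\<dots> = (\<Sum>k\<in>I. (f k * A) $$ (i,j))"
    using assms ij by (intro sum.cong refl) (simp add: mult_mat_index[of _ m n A l])
  finally show "(mat_sum m n I f * A) $$ (i,j) = mat_sum m l I (\<lambda>k. f k * A) $$ (i,j)" using ij by simp
qed (use assms in auto)

lemma kron_mat_sum_left:
  assumes "B \<in> carrier_mat m' n'" "\<And>k. k \<in> I \<Longrightarrow> f k \<in> carrier_mat m n"
  shows "kron_mat (mat_sum m n I f) B = mat_sum (m*m') (n*n') I (\<lambda>k. kron_mat (f k) B)"
proof (rule eq_mat_pairI[of _ m m' n n'])
  fix i j k l assume i: "i < m" "j < m'" "k < n" "l < n'"
  have "kron_mat (mat_sum m n I f) B $$ (i*m'+j, k*n'+l) = (\<Sum>x\<in>I. f x $$ (i,k) * B $$ (j,l))"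
    using i assms(1) by (simp add: kron_mat_index[of _ m n B m' n'] sum_distrib_right)
  also have "\<dots> = (\<Sum>x\<in>I. kron_mat (f x) B $$ (i*m'+j, k*n'+l))"
    using i assms by (intro sum.cong refl) (simp add: kron_mat_index[of _ m n B m' n'])
  finally show "kron_mat (mat_sum m n I f) B $$ (i*m'+j, k*n'+l)
      = mat_sum (m*m') (n*n') I (\<lambda>k. kron_mat (f k) B) $$ (i*m'+j, k*n'+l)"
    using i by (simp add: pair_index_less)
qed (use assms in auto)

lemma kron_mat_sum_right:
  assumes "B \<in> carrier_mat m' n'" "\<And>k. k \<in> I \<Longrightarrow> f k \<in> carrier_mat m n"
  shows "kron_mat B (mat_sum m n I f) = mat_sum (m'*m) (n'*n) I (\<lambda>k. kron_mat B (f k))"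
proof (rule eq_mat_pairI[of _ m' m n' n])
  fix i j k l assume i: "i < m'" "j < m" "k < n'" "l < n"
  have "kron_mat B (mat_sum m n I f) $$ (i*m+j, k*n+l) = (\<Sum>x\<in>I. B $$ (i,k) * f x $$ (j,l))"
    using i assms(1) by (simp add: kron_mat_index[of B m' n' _ m n] sum_distrib_left)
  also have "\<dots> = (\<Sum>x\<in>I. kron_mat B (f x) $$ (i*m+j, k*n+l))"
    using i assms by (intro sum.cong refl) (simp add: kron_mat_index[of B m' n' _ m n])
  finally show "kron_mat B (mat_sum m n I f) $$ (i*m+j, k*n+l)
      = mat_sum (m'*m) (n'*n) I (\<lambda>k. kron_mat B (f k)) $$ (i*m+j, k*n+l)"
    using i by (simp add: pair_index_less)
qed (use assms in auto)

section \<open>An isometry from two families of vectors with equal Gram matrices\<close>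

lemma cscalar_eq_sum:
  "v \<in> carrier_vec n \<Longrightarrow> w \<in> carrier_vec n \<Longrightarrow> v \<bullet>c w = (\<Sum>i<n. v $ i * cnj (w $ i))"
  for v w :: "complex vec"
  by (simp add: scalar_prod_def atLeast0LessThan)

lemma cnj_cscalar: "v \<in> carrier_vec n \<Longrightarrow> w \<in> carrier_vec n \<Longrightarrow> cnj (v \<bullet>c w) = w \<bullet>c v"
  for v w :: "complex vec"
  by (simp add: cscalar_eq_sum[of _ n] mult.commute)

text \<open>The witness is \<open>W = C\<^sup>-\<^sup>1 \<Sum>\<^sub>k x\<^sub>k y\<^sub>k\<^sup>*\<close>; tightness of the frame \<open>y\<close> gives \<open>W\<^sup>* x\<^sub>k = y\<^sub>k\<close>, and
  then \<open>W y\<^sub>k = x\<^sub>k\<close> because \<open>\<langle>W y\<^sub>k, x\<^sub>k\<rangle>\<close> and both squared norms equal \<open>\<langle>y\<^sub>k, y\<^sub>k\<rangle>\<close>.\<close>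

lemma frame_isometry:
  fixes x y :: "'i \<Rightarrow> complex vec" and C :: complex
  assumes x: "\<And>k. k \<in> I \<Longrightarrow> x k \<in> carrier_vec m" and y: "\<And>k. k \<in> I \<Longrightarrow> y k \<in> carrier_vec n"
    and gram: "\<And>k l. k \<in> I \<Longrightarrow> l \<in> I \<Longrightarrow> x k \<bullet>c x l = y k \<bullet>c y l"
    and frame: "\<And>i j. i < n \<Longrightarrow> j < n \<Longrightarrow> (\<Sum>k\<in>I. y k $ i * cnj (y k $ j)) = (if i = j then C else 0)"
    and C: "C \<noteq> 0" "cnj C = C"
  obtains W where "W \<in> carrier_mat m n" "mat_adjoint W * W = 1\<^sub>m n"
    "\<And>k. k \<in> I \<Longrightarrow> W *\<^sub>v y k = x k"
proof -
  define W where "W = mat m n (\<lambda>(i,j). (\<Sum>k\<in>I. x k $ i * cnj (y k $ j)) / C)"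
  have W: "W \<in> carrier_mat m n" by (simp add: W_def)
  have Wx: "mat_adjoint W *\<^sub>v x l = y l" if l: "l \<in> I" for l
  proof (rule eq_vecI)
    fix j assume "j < dim_vec (y l)"
    then have j: "j < n" using y[OF l] by simp
    have "(mat_adjoint W *\<^sub>v x l) $ j = (\<Sum>i<m. (\<Sum>k\<in>I. cnj (x k $ i) * y k $ j) * x l $ i) / C"
      using j W x[OF l] C
      by (simp add: scalar_prod_def atLeast0LessThan W_def sum_divide_distrib[symmetric])
    also have "(\<Sum>i<m. (\<Sum>k\<in>I. cnj (x k $ i) * y k $ j) * x l $ i)
        = (\<Sum>k\<in>I. \<Sum>i<m. x l $ i * cnj (x k $ i) * y k $ j)"
      unfolding sum_distrib_right by (subst sum.swap) (simp add: mult_ac)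
    also have "\<dots> = (\<Sum>k\<in>I. (x l \<bullet>c x k) * y k $ j)"
      using x l by (intro sum.cong refl) (simp add: cscalar_eq_sum[of _ m] sum_distrib_right)
    \<comment> \<open>The Gram hypothesis replaces the inner product of \<open>x l\<close> and
      \<open>x k\<close> by that of \<open>y l\<close> and \<open>y k\<close>. From here on only
      \<open>y\<close> occurs, and the frame identity can be applied.\<close>
    also have "\<dots> = (\<Sum>k\<in>I. \<Sum>i<n. y l $ i * cnj (y k $ i) * y k $ j)"
      using y l gram by (intro sum.cong refl) (simp add: cscalar_eq_sum[of _ n] sum_distrib_right)
    also have "\<dots> = (\<Sum>i<n. y l $ i * (\<Sum>k\<in>I. y k $ j * cnj (y k $ i)))"
      unfolding sum_distrib_left by (subst sum.swap) (simp add: mult_ac)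
    also have "\<dots> = y l $ j * C"
      using j by (simp add: frame if_distrib[of "\<lambda>z. _ * z"] cong: if_cong)
    finally show "(mat_adjoint W *\<^sub>v x l) $ j = y l $ j" using C by simp
  qed (use W y[OF l] in auto)
  \<comment> \<open>Applying the adjoint of \<open>W\<close> to the columns x_k in the definition of
    \<open>W\<close> turns them into y_k, so the product is the frame operator of \<open>y\<close>
    divided by \<open>C\<close>.\<close>
  have iso: "mat_adjoint W * W = 1\<^sub>m n"
  proof (rule eq_matI)
    fix i j assume "i < dim_row (1\<^sub>m n :: complex mat)" "j < dim_col (1\<^sub>m n :: complex mat)"
    then have ij: "i < n" "j < n" by auto
    have "(mat_adjoint W * W) $$ (i,j) = (\<Sum>a<m. mat_adjoint W $$ (i,a) * (\<Sum>k\<in>I. x k $ a * cnj (y k $ j)) / C)"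
      using ij W by (subst mult_mat_index[of _ n m _ n]) (auto simp: W_def)
    also have "\<dots> = (\<Sum>k\<in>I. \<Sum>a<m. mat_adjoint W $$ (i,a) * x k $ a * cnj (y k $ j)) / C"
      unfolding sum_divide_distrib[symmetric] sum_distrib_left by (subst sum.swap) (simp add: mult_ac)
    also have "(\<Sum>k\<in>I. \<Sum>a<m. mat_adjoint W $$ (i,a) * x k $ a * cnj (y k $ j))
        = (\<Sum>k\<in>I. (mat_adjoint W *\<^sub>v x k) $ i * cnj (y k $ j))"
    proof (intro sum.cong refl)
      fix k assume k: "k \<in> I"
      show "(\<Sum>a<m. mat_adjoint W $$ (i,a) * x k $ a * cnj (y k $ j)) = (mat_adjoint W *\<^sub>v x k) $ i * cnj (y k $ j)"
        using x[OF k] ij W by (simp add: scalar_prod_def atLeast0LessThan sum_distrib_right)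
    qed
    also have "\<dots> = (\<Sum>k\<in>I. y k $ i * cnj (y k $ j))" by (simp add: Wx)
    finally show "(mat_adjoint W * W) $$ (i,j) = 1\<^sub>m n $$ (i,j)"
      using ij C by (simp add: frame)
  qed (use W in auto)
  have "W *\<^sub>v y k = x k" if k: "k \<in> I" for k
  proof -
    define z where "z = W *\<^sub>v y k - x k"
    have c: "W *\<^sub>v y k \<in> carrier_vec m" "x k \<in> carrier_vec m" "y k \<in> carrier_vec n" "mat_adjoint W \<in> carrier_mat n m"
      using W x[OF k] y[OF k] by auto
    have 1: "(W *\<^sub>v y k) \<bullet>c (W *\<^sub>v y k) = y k \<bullet>c y k"
    proof -
      have "(W *\<^sub>v y k) \<bullet>c (W *\<^sub>v y k) = y k \<bullet>c (mat_adjoint W *\<^sub>v (W *\<^sub>v y k))"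
        using W c by (intro cscalar_mult_mat_vec) auto
      also have "mat_adjoint W *\<^sub>v (W *\<^sub>v y k) = y k"
        using assoc_mult_mat_vec[OF c(4) W c(3)] iso c by simp
      finally show ?thesis .
    qed
    have 2: "(W *\<^sub>v y k) \<bullet>c x k = y k \<bullet>c y k"
      using cscalar_mult_mat_vec[OF W c(3) c(2)] Wx[OF k] by simp
    have 3: "x k \<bullet>c (W *\<^sub>v y k) = y k \<bullet>c y k"
      using 2 c cnj_cscalar by metis
    have "z \<bullet>c z = (W *\<^sub>v y k) \<bullet>c (W *\<^sub>v y k) - (W *\<^sub>v y k) \<bullet>c x k - (x k \<bullet>c (W *\<^sub>v y k) - x k \<bullet>c x k)"
      using c W unfolding z_def
      by (simp add: cscalar_eq_sum[of _ m] sum_subtractf[symmetric] algebra_simps del: index_mult_mat_vec)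
    also have "\<dots> = 0" using 1 2 3 gram[OF k k] by simp
    finally have "z = 0\<^sub>v m" using c unfolding z_def by (intro iffD1[OF conjugate_square_eq_0_vec]) auto
    then have "z $ i = 0" if "i < m" for i using that by simp
    then show ?thesis using c unfolding z_def by (intro eq_vecI) auto
  qed
  with W iso that show ?thesis by blast
qed

section \<open>Schur orthogonality\<close>

text \<open>Schur's lemma. Over the complex numbers and with d > 0 the matrix \<open>Q\<close> has
  an eigenvalue c; its eigenspace is invariant because \<open>Q\<close> commutes with the
  representation, and it is nonzero, so irreducibility makes it the whole space.\<close>

lemma schur_commutant:
  assumes irr: "irreducible_rep G d p" and rep: "unitary_rep G d p"
    and Q: "Q \<in> carrier_mat d d" and comm: "\<And>s. s \<in> carrier G \<Longrightarrow> p s * Q = Q * p s"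
  shows "\<exists>c. Q = c \<cdot>\<^sub>m 1\<^sub>m d"
proof -
  have d: "d > 0" using irr by (simp add: irreducible_rep_def)
  have p: "p s \<in> carrier_mat d d" if "s \<in> carrier G" for s
    using rep that by (simp add: unitary_rep_def unitary_in_def)
  obtain c where "eigenvalue Q c"
    using spectrum_non_empty[OF Q d] by (auto simp: spectrum_def)
  then obtain v where v: "v \<in> carrier_vec d" "v \<noteq> 0\<^sub>v d" "Q *\<^sub>v v = c \<cdot>\<^sub>v v"
    using Q by (auto simp: eigenvalue_def eigenvector_def)
  define V where "V = {w \<in> carrier_vec d. Q *\<^sub>v w = c \<cdot>\<^sub>v w}"
  have "is_subspace d V"
    unfolding is_subspace_def V_def using Q
    by (auto simp: mult_add_distrib_mat_vec[OF Q] smult_add_distrib_vec[of _ d] mult_mat_vec[OF Q]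
        smult_smult_assoc mult.commute)
  moreover have "p s *\<^sub>v w \<in> V" if s: "s \<in> carrier G" and w: "w \<in> V" for s w
  proof -
    have wd: "w \<in> carrier_vec d" "Q *\<^sub>v w = c \<cdot>\<^sub>v w" using w by (auto simp: V_def)
    have "Q *\<^sub>v (p s *\<^sub>v w) = (p s * Q) *\<^sub>v w"
      using comm[OF s] assoc_mult_mat_vec[OF Q p[OF s] wd(1)] by simp
    also have "\<dots> = c \<cdot>\<^sub>v (p s *\<^sub>v w)"
      using assoc_mult_mat_vec[OF p[OF s] Q wd(1)] mult_mat_vec[OF p[OF s] wd(1)] wd(2) by simp
    finally show ?thesis using wd p[OF s] by (auto simp: V_def)
  qed
  moreover have "V \<noteq> {0\<^sub>v d}" using v by (auto simp: V_def)
  ultimately have V: "V = carrier_vec d" using irr by (auto simp: irreducible_rep_def)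
  have "Q = c \<cdot>\<^sub>m 1\<^sub>m d"
  proof (rule mat_eqI_mult_vec)
    fix w :: "complex vec" assume w: "w \<in> carrier_vec d"
    then have "Q *\<^sub>v w = c \<cdot>\<^sub>v w" using V by (auto simp: V_def)
    also have "\<dots> = (c \<cdot>\<^sub>m 1\<^sub>m d) *\<^sub>v w"
      using w by (intro eq_vecI) (auto simp: scalar_prod_def if_distrib[of "\<lambda>z. _ * z"] if_distrib[of "\<lambda>z. z * _"] cong: if_cong)
    finally show "Q *\<^sub>v w = (c \<cdot>\<^sub>m 1\<^sub>m d) *\<^sub>v w" .
  qed (use Q in auto)
  then show ?thesis by blast
qed

definition mat_unit :: "nat \<Rightarrow> nat \<Rightarrow> nat \<Rightarrow> complex mat" where
  "mat_unit d i j = mat d d (\<lambda>(a,b). if a = i \<and> b = j then 1 else 0)"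

lemma mat_unit_carrier [simp]: "mat_unit d i j \<in> carrier_mat d d"
  by (simp add: mat_unit_def)

lemma mat_unit_index [simp]:
  "a < d \<Longrightarrow> b < d \<Longrightarrow> mat_unit d i j $$ (a,b) = (if a = i \<and> b = j then 1 else 0)"
  by (simp add: mat_unit_def)

text \<open>Averaging the matrix unit e_jl over the group gives a matrix \<open>Q\<close> in the
  commutant, hence a scalar c by Schur's lemma. The sum in question is the entry (i,k) of
  \<open>Q\<close>, and the trace of \<open>Q\<close> determines c.\<close>

lemma schur_orthogonality:
  fixes G (structure)
  assumes G: "group G" "finite (carrier G)"
    and irr: "irreducible_rep G d p" and rep: "unitary_rep G d p"
    and ijkl: "i < d" "j < d" "k < d" "l < d"
  shows "(\<Sum>s\<in>carrier G. p s $$ (i,j) * cnj (p s $$ (k,l)))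
    = (if i = k \<and> j = l then of_nat (card (carrier G)) / of_nat d else 0)"
proof -
  interpret group G by (rule G)
  have p: "p s \<in> carrier_mat d d" "mat_adjoint (p s) \<in> carrier_mat d d" "mat_adjoint (p s) * p s = 1\<^sub>m d" if "s \<in> carrier G" for s
    using rep that by (auto simp: unitary_rep_def unitary_in_def)
  define A where "A = mat_unit d j l"
  have A: "A \<in> carrier_mat d d" by (simp add: A_def)
  define f where "f s = p s * A * mat_adjoint (p s)" for s
  have f: "f s \<in> carrier_mat d d" if "s \<in> carrier G" for s
    using p(1,2)[OF that] A by (auto simp: f_def intro!: mult_carrier_mat)
  define Q where "Q = mat_sum d d (carrier G) f"
  have fidx: "f s $$ (a,b) = p s $$ (a,j) * cnj (p s $$ (b,l))" if s: "s \<in> carrier G" and "a < d" "b < d" for s a b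
  proof -
    have 1: "(p s * A) $$ (a,x) = (if x = l then p s $$ (a,j) else 0)" if "x < d" for x
      using p(1)[OF s] \<open>a < d\<close> that ijkl
      by (subst mult_mat_index[of _ d d _ d]) (auto simp: A_def if_distrib[of "\<lambda>z. _ * z"] cong: if_cong)
    have "f s $$ (a,b) = (\<Sum>x<d. (p s * A) $$ (a,x) * mat_adjoint (p s) $$ (x,b))"
      unfolding f_def using p[OF s] A that by (intro mult_mat_index) auto
    also have "\<dots> = (\<Sum>x<d. (if x = l then p s $$ (a,j) * mat_adjoint (p s) $$ (x,b) else 0))"
      by (intro sum.cong refl) (simp add: 1)
    also have "\<dots> = p s $$ (a,j) * cnj (p s $$ (b,l))"
      using p(1)[OF s] that ijkl by simp
    finally show ?thesis .
  qed
  have "p g * Q = Q * p g" if g: "g \<in> carrier G" for g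
  proof -
    \<comment> \<open>Left translation by \<open>g\<close> merely permutes the summands. In the
      translated summand the trailing adjoint of \<open>p g\<close> cancels against the factor
      \<open>p g\<close> on the right, which leaves \<open>p g * f s\<close>.\<close>
    have "mat_sum d d (carrier G) f = mat_sum d d (carrier G) (\<lambda>s. f (g \<otimes> s))"
    proof -
      have "(\<Sum>s\<in>carrier G. f s $$ (a,b)) = (\<Sum>s\<in>carrier G. f (g \<otimes> s) $$ (a,b))" for a b
      proof (rule sum.reindex_bij_witness[of _ "\<lambda>s. g \<otimes> s" "\<lambda>s. inv g \<otimes> s"])
      qed (use g in \<open>auto simp: m_assoc[symmetric]\<close>)
      then show ?thesis by (simp add: mat_sum_def)
    qed
    then have "Q * p g = mat_sum d d (carrier G) (\<lambda>s. f (g \<otimes> s)) * p g"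
      by (simp add: Q_def)
    also have "\<dots> = mat_sum d d (carrier G) (\<lambda>s. f (g \<otimes> s) * p g)"
      using p g f by (intro mat_sum_mult) auto
    also have "\<dots> = mat_sum d d (carrier G) (\<lambda>s. p g * f s)"
    proof (rule mat_sum_cong)
      fix s assume s: "s \<in> carrier G"
      have m: "p (g \<otimes> s) = p g * p s" using rep g s by (simp add: unitary_rep_def)
      have "f (g \<otimes> s) * p g = p g * p s * A * (mat_adjoint (p s) * mat_adjoint (p g)) * p g"
        unfolding f_def m using mat_adjoint_mult[OF p(1)[OF g] p(1)[OF s]] by simp
      also have "\<dots> = p g * f s * (mat_adjoint (p g) * p g)"
        unfolding f_def using p(1,2)[OF g] p(1,2)[OF s] A
        by (simp add: assoc_mult_mat[of _ d d _ d _ d] mult_carrier_mat[of _ d d _ d])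
      also have "\<dots> = p g * f s" using p[OF g] f[OF s] by (simp add: mult_carrier_mat[of _ d d _ d] right_mult_one_mat[of _ d d])
      finally show "f (g \<otimes> s) * p g = p g * f s" .
    qed
    also have "\<dots> = p g * Q"
      unfolding Q_def using p g f by (subst mult_mat_sum[of _ d d]) auto
    finally show ?thesis by simp
  qed
  moreover have Q: "Q \<in> carrier_mat d d" by (simp add: Q_def)
  ultimately obtain c where c: "Q = c \<cdot>\<^sub>m 1\<^sub>m d"
    using schur_commutant[OF irr rep] by blast
  have Qi: "(\<Sum>s\<in>carrier G. p s $$ (a,j) * cnj (p s $$ (b,l))) = (if a = b then c else 0)" if "a < d" "b < d" for a b
  proof -
    have "(\<Sum>s\<in>carrier G. p s $$ (a,j) * cnj (p s $$ (b,l))) = Q $$ (a,b)"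
      using that by (simp add: Q_def fidx)
    then show ?thesis using that c by simp
  qed
  \<comment> \<open>This is the trace of \<open>Q\<close>. Each group element contributes the inner
    product of columns j and l of the unitary \<open>p s\<close>, that is 1 for j = l and 0
    otherwise.\<close>
  have "of_nat d * c = (\<Sum>a<d. \<Sum>s\<in>carrier G. p s $$ (a,j) * cnj (p s $$ (a,l)))"
    by (simp add: Qi)
  also have "\<dots> = (\<Sum>s\<in>carrier G. \<Sum>a<d. cnj (p s $$ (a,l)) * p s $$ (a,j))"
    by (subst sum.swap) (simp add: mult.commute)
  also have "\<dots> = (\<Sum>s\<in>carrier G. if j = l then 1 else 0)"
  proof (intro sum.cong refl)
    fix s assume s: "s \<in> carrier G"
    have "(\<Sum>a<d. cnj (p s $$ (a,l)) * p s $$ (a,j)) = (mat_adjoint (p s) * p s) $$ (l,j)"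
      using p(1)[OF s] ijkl by (subst mult_mat_index[of _ d d _ d]) auto
    then show "(\<Sum>a<d. cnj (p s $$ (a,l)) * p s $$ (a,j)) = (if j = l then 1 else 0)"
      using p(3)[OF s] ijkl by simp
  qed
  finally have "of_nat d * c = (if j = l then of_nat (card (carrier G)) else 0)" by simp
  moreover have "d > 0" using ijkl by simp
  ultimately have "c = (if j = l then of_nat (card (carrier G)) / of_nat d else 0)"
    by (auto simp: field_simps)
  then show ?thesis using Qi[of i k] ijkl by simp
qed

text \<open>Fourier inversion for a single irreducible representation: d/|G| is the reciprocal of
  the constant in the orthogonality relations. The same coefficients, with the unknown unitaries of
  a model in place of \<open>p s\<close>, later define the blocks of the local isometries.\<close>

lemma mat_unit_eq_rep_sum:
  fixes G (structure)
  assumes "group G" "finite (carrier G)" "irreducible_rep G d p" "unitary_rep G d p" "i < d" "j < d"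
  shows "mat_sum d d (carrier G)
    (\<lambda>s. (of_nat d / of_nat (card (carrier G)) * cnj (p s $$ (i,j))) \<cdot>\<^sub>m p s) = mat_unit d i j"
proof (rule eq_matI)
  interpret group G by fact
  have n: "card (carrier G) > 0" using assms(2) by (auto simp: card_gt_0_iff)
  have p: "p s \<in> carrier_mat d d" if "s \<in> carrier G" for s
    using assms(4) that by (auto simp: unitary_rep_def unitary_in_def)
  fix a b assume "a < dim_row (mat_unit d i j)" "b < dim_col (mat_unit d i j)"
  then have ab: "a < d" "b < d" by (auto simp: mat_unit_def)
  have "(\<Sum>s\<in>carrier G. ((of_nat d / of_nat (card (carrier G)) * cnj (p s $$ (i,j))) \<cdot>\<^sub>m p s) $$ (a,b))
    = (\<Sum>s\<in>carrier G. of_nat d / of_nat (card (carrier G)) * (p s $$ (a,b) * cnj (p s $$ (i,j))))"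
    using p ab by (intro sum.cong refl) (simp add: carrier_matD[OF p])
  also have "\<dots> = mat_unit d i j $$ (a,b)"
    unfolding sum_distrib_left[symmetric] schur_orthogonality[OF assms(1-4) ab assms(5,6)]
    using n ab by auto
  finally show "mat_sum d d (carrier G)
    (\<lambda>s. (of_nat d / of_nat (card (carrier G)) * cnj (p s $$ (i,j))) \<cdot>\<^sub>m p s) $$ (a,b) = mat_unit d i j $$ (a,b)"
    using ab by simp
qed (auto simp: mat_unit_def)

text \<open>Burnside's theorem for a finite group: \<open>B\<close> is a combination of matrix units
  with its entries as coefficients, and each matrix unit is a combination of the
  \<open>p s\<close>.\<close>

lemma rep_span:
  fixes G (structure)
  assumes "group G" "finite (carrier G)" "irreducible_rep G d p" "unitary_rep G d p" "B \<in> carrier_mat d d"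
  obtains c where "B = mat_sum d d (carrier G) (\<lambda>s. c s \<cdot>\<^sub>m p s)"
proof
  define c where "c s = (\<Sum>i<d. \<Sum>j<d. B $$ (i,j) * (of_nat d / of_nat (card (carrier G)) * cnj (p s $$ (i,j))))" for s
  have p: "p s \<in> carrier_mat d d" if "s \<in> carrier G" for s
    using assms(4) that by (auto simp: unitary_rep_def unitary_in_def)
  show "B = mat_sum d d (carrier G) (\<lambda>s. c s \<cdot>\<^sub>m p s)"
  proof (rule eq_matI)
    fix a b assume "a < dim_row (mat_sum d d (carrier G) (\<lambda>s. c s \<cdot>\<^sub>m p s))"
      "b < dim_col (mat_sum d d (carrier G) (\<lambda>s. c s \<cdot>\<^sub>m p s))"
    then have ab: "a < d" "b < d" by auto
    have U: "(\<Sum>s\<in>carrier G. of_nat d / of_nat (card (carrier G)) * cnj (p s $$ (i,j)) * p s $$ (a,b))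
      = mat_unit d i j $$ (a,b)" if "i < d" "j < d" for i j
      unfolding mat_unit_eq_rep_sum[OF assms(1-4) that, symmetric]
      using ab by (simp add: carrier_matD[OF p])
    have "mat_sum d d (carrier G) (\<lambda>s. c s \<cdot>\<^sub>m p s) $$ (a,b) = (\<Sum>s\<in>carrier G. c s * p s $$ (a,b))"
      using ab by (simp add: carrier_matD[OF p])
    also have "\<dots> = (\<Sum>i<d. \<Sum>j<d. B $$ (i,j) *
        (\<Sum>s\<in>carrier G. of_nat d / of_nat (card (carrier G)) * cnj (p s $$ (i,j)) * p s $$ (a,b)))"
      unfolding c_def sum_distrib_right sum_distrib_left
      by (subst sum.swap, intro sum.cong refl, subst sum.swap) (simp add: mult_ac)
    also have "\<dots> = (\<Sum>i<d. \<Sum>j<d. if b = j then if a = i then B $$ (a,b) else 0 else 0)"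
      using ab by (intro sum.cong refl) (subst U; auto)
    also have "\<dots> = B $$ (a,b)" using ab by simp
    finally show "B $$ (a,b) = mat_sum d d (carrier G) (\<lambda>s. c s \<cdot>\<^sub>m p s) $$ (a,b)" by simp
  qed (use assms in auto)
qed

text \<open>After expansion the double sum over the group splits into one orthogonality sum for
  \<open>p\<close> and one for \<open>r\<close>. These contribute |G|/m and |G|/n and force the
  summation indices belonging to \<open>psi\<close> and to its conjugate to agree, so the remaining
  factor is the squared norm of \<open>psi\<close>, which is 1.\<close>

lemma tensor_orbit_frame:
  fixes G (structure)
  assumes G: "group G" "finite (carrier G)"
    and p: "irreducible_rep G m p" "unitary_rep G m p"
    and r: "irreducible_rep G n r" "unitary_rep G n r"
    and psi: "unit_vec_in (m*n) psi"
    and x: "x < m*n" and y: "y < m*n"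
  shows "(\<Sum>(s,t)\<in>carrier G \<times> carrier G. (kron_mat (p s) (r t) *\<^sub>v psi) $ x * cnj ((kron_mat (p s) (r t) *\<^sub>v psi) $ y))
    = (if x = y then of_nat (card (carrier G)) / of_nat m * (of_nat (card (carrier G)) / of_nat n) else 0)"
    (is "?L = _")
proof -
  let ?N = "of_nat (card (carrier G)) :: complex"
  have pc: "p s \<in> carrier_mat m m" if "s \<in> carrier G" for s
    using p(2) that by (auto simp: unitary_rep_def unitary_in_def)
  have rc: "r s \<in> carrier_mat n n" if "s \<in> carrier G" for s
    using r(2) that by (auto simp: unitary_rep_def unitary_in_def)
  have psic: "psi \<in> carrier_vec (m*n)" and psi1: "psi \<bullet>c psi = 1"
    using psi by (auto simp: unit_vec_in_def)
  obtain i j where ij: "i < m" "j < n" "x = i*n+j" using x by (rule pair_index_cases)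
  obtain k l where kl: "k < m" "l < n" "y = k*n+l" using y by (rule pair_index_cases)
  define A where "A a c = (\<Sum>s\<in>carrier G. p s $$ (i,a) * cnj (p s $$ (k,c)))" for a c
  define B where "B b d = (\<Sum>t\<in>carrier G. r t $$ (j,b) * cnj (r t $$ (l,d)))" for b d
  have "?L = (\<Sum>s\<in>carrier G. \<Sum>t\<in>carrier G. (\<Sum>a<m. \<Sum>b<n. p s $$ (i,a) * r t $$ (j,b) * psi $ (a*n+b)) *
      (\<Sum>c<m. \<Sum>d<n. cnj (p s $$ (k,c) * r t $$ (l,d) * psi $ (c*n+d))))"
    unfolding sum.cartesian_product[symmetric]
    using ij kl by (intro sum.cong refl) (simp add: kron_mat_mult_vec_index[OF pc rc psic])
  also have "\<dots> = (\<Sum>s\<in>carrier G. \<Sum>t\<in>carrier G. \<Sum>a<m. \<Sum>b<n. \<Sum>c<m. \<Sum>d<n. 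
      (p s $$ (i,a) * cnj (p s $$ (k,c))) * (r t $$ (j,b) * cnj (r t $$ (l,d))) * (psi $ (a*n+b) * cnj (psi $ (c*n+d))))"
    unfolding sum_distrib_right unfolding sum_distrib_left
    by (intro sum.cong refl) (simp add: mult_ac)
  also have "\<dots> = (\<Sum>a<m. \<Sum>b<n. \<Sum>c<m. \<Sum>d<n. \<Sum>s\<in>carrier G. \<Sum>t\<in>carrier G.
      (p s $$ (i,a) * cnj (p s $$ (k,c))) * (r t $$ (j,b) * cnj (r t $$ (l,d))) * (psi $ (a*n+b) * cnj (psi $ (c*n+d))))"
    by (simp only: sum.swap[of _ "carrier G" "{..<m}"] sum.swap[of _ "carrier G" "{..<n}"])
  also have "\<dots> = (\<Sum>a<m. \<Sum>b<n. \<Sum>c<m. \<Sum>d<n. A a c * B b d * (psi $ (a*n+b) * cnj (psi $ (c*n+d))))"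
    unfolding A_def B_def sum_product unfolding sum_distrib_right ..
  \<comment> \<open>\<open>A a c\<close> vanishes unless i = k and a = c, and \<open>B b d\<close>
    unless j = l and b = d. The conditions i = k and j = l together say x = y, since the pair index
    is injective.\<close>
  also have "\<dots> = (\<Sum>a<m. \<Sum>b<n. \<Sum>c<m. \<Sum>d<n. if d = b then if c = a then
      (if x = y then ?N / of_nat m * (?N / of_nat n) else 0) * (psi $ (a*n+b) * cnj (psi $ (a*n+b))) else 0 else 0)"
  proof (intro sum.cong refl, goal_cases)
    case (1 a b c d)
    have "x = y \<longleftrightarrow> i = k \<and> j = l" using ij kl by (metis pair_index_div pair_index_mod)
    then show ?case
      using 1 ij kl schur_orthogonality[OF G p ij(1) _ kl(1), of a c] schur_orthogonality[OF G r ij(2) _ kl(2), of b d]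
      by (auto simp: A_def B_def)
  qed
  also have "\<dots> = (\<Sum>a<m. \<Sum>b<n. (if x = y then ?N / of_nat m * (?N / of_nat n) else 0) * (psi $ (a*n+b) * cnj (psi $ (a*n+b))))"
    by (intro sum.cong refl) (simp add: if_distrib[of "sum _"] cong: if_cong)
  also have "\<dots> = (if x = y then ?N / of_nat m * (?N / of_nat n) else 0) * (psi \<bullet>c psi)"
    unfolding cscalar_eq_sum[OF psic psic] sum_lessThan_mult sum_distrib_left ..
  finally show ?thesis using psi1 by simp
qed

section \<open>Unistochastic operator matrices and full rank vectors\<close>

text \<open>Diagonal entries are positive, here with an explicit factor \<open>U\<close>. This is
  what turns a vanishing expectation \<langle>(E \<otimes> 1)\<xi>,\<xi>\<rangle> into the vanishing
  of the vector (U \<otimes> 1)\<xi>.\<close>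

lemma usom_diag_square:
  assumes "usom G d E" "s \<in> carrier G" "g \<in> carrier G"
  obtains U where "U \<in> carrier_mat d d" "E s s g g = mat_adjoint U * U"
  using assms unfolding usom_def by blast

text \<open>Column unitarity says that for fixed \<open>s\<close> the diagonal entries form a
  resolution of the identity indexed by \<open>g\<close>. Summing over the output of one party thus
  removes its operator from the correlation.\<close>

lemma usom_sum_diag:
  assumes "usom G d E" "s \<in> carrier G"
  shows "mat_sum d d (carrier G) (\<lambda>g. E s s g g) = 1\<^sub>m d"
proof -
  obtain U where U: "\<forall>s\<in>carrier G. \<forall>s'\<in>carrier G.
        msum d (carrier G) (\<lambda>g. mat_adjoint (U g s) * U g s') = (if s = s' then 1\<^sub>m d else 0\<^sub>m d d)"
     "\<forall>s\<in>carrier G. \<forall>s'\<in>carrier G. \<forall>g\<in>carrier G. \<forall>g'\<in>carrier G.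
        E s s' g g' = mat_adjoint (U g s) * U g' s'"
    using assms(1) unfolding usom_def by blast
  have "mat_sum d d (carrier G) (\<lambda>g. E s s g g) = mat_sum d d (carrier G) (\<lambda>g. mat_adjoint (U g s) * U g s)"
    using U(2) assms(2) by (intro mat_sum_cong) auto
  then show ?thesis using U(1) assms(2) by (simp add: msum_eq_mat_sum)
qed

lemma mat_sum_single:
  assumes "finite I" "k \<in> I" "f k \<in> carrier_mat m n" "\<And>l. l \<in> I \<Longrightarrow> l \<noteq> k \<Longrightarrow> f l = 0\<^sub>m m n"
  shows "mat_sum m n I f = f k"
proof (rule eq_matI)
  fix i j assume "i < dim_row (f k)" "j < dim_col (f k)"
  then have ij: "i < m" "j < n" using assms(3) by auto
  have "(\<Sum>l\<in>I. f l $$ (i,j)) = (\<Sum>l\<in>{k}. f l $$ (i,j))"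
    using assms ij by (intro sum.mono_neutral_right) auto
  then show "mat_sum m n I f $$ (i,j) = f k $$ (i,j)" using ij by simp
qed (use assms in auto)

text \<open>The diagonal entries of the product are the squared norms of the columns of
  \<open>A\<close>.\<close>

lemma adjoint_mult_self_eq_0:
  fixes A :: "complex mat"
  assumes "A \<in> carrier_mat m n" "mat_adjoint A * A = 0\<^sub>m n n"
  shows "A = 0\<^sub>m m n"
proof (rule eq_matI)
  fix i j assume "i < dim_row (0\<^sub>m m n :: complex mat)" "j < dim_col (0\<^sub>m m n :: complex mat)"
  then have ij: "i < m" "j < n" by auto
  have "(\<Sum>k<m. (cmod (A $$ (k,j)))\<^sup>2) = 0"
  proof -
    have "complex_of_real (\<Sum>k<m. (cmod (A $$ (k,j)))\<^sup>2) = (mat_adjoint A * A) $$ (j,j)"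
      using assms(1) ij by (subst mult_mat_index[of _ n m _ n]) (auto simp: complex_norm_square mult.commute simp del: of_real_power)
    then show ?thesis using assms(2) ij by (simp only: index_zero_mat of_real_eq_0_iff)
  qed
  then show "A $$ (i,j) = 0\<^sub>m m n $$ (i,j)" using ij by (simp add: sum_nonneg_eq_0_iff)
qed (use assms in auto)

text \<open>The hypothesis says that the blocks U_gs with g \<noteq> s have vanishing square, so the
  block unitary is diagonal. Multiplying all blocks on the left by one unitary does not change the
  USOM; the adjoint of the block at the group unit is taken, which normalises
  \<open>A \<one>\<close> to the identity.\<close>

lemma usom_diagonal:
  fixes G (structure)
  assumes G: "group G" "finite (carrier G)" and E: "usom G d E"
    and off: "\<And>s g. s \<in> carrier G \<Longrightarrow> g \<in> carrier G \<Longrightarrow> g \<noteq> s \<Longrightarrow> E s s g g = 0\<^sub>m d d"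
  obtains A where "\<And>s. s \<in> carrier G \<Longrightarrow> unitary_in d (A s)" "A \<one> = 1\<^sub>m d"
    "\<And>s s' g g'. s \<in> carrier G \<Longrightarrow> s' \<in> carrier G \<Longrightarrow> g \<in> carrier G \<Longrightarrow> g' \<in> carrier G \<Longrightarrow>
      E s s' g g' = (if g = s \<and> g' = s' then mat_adjoint (A s) * A s' else 0\<^sub>m d d)"
proof -
  interpret group G by (rule G)
  from E[unfolded usom_def] obtain U where
    U: "(\<forall>g\<in>carrier G. \<forall>s\<in>carrier G. U g s \<in> carrier_mat d d) \<and>
     (\<forall>s\<in>carrier G. \<forall>s'\<in>carrier G.
        msum d (carrier G) (\<lambda>g. mat_adjoint (U g s) * U g s') = (if s = s' then 1\<^sub>m d else 0\<^sub>m d d)) \<and>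
     (\<forall>g\<in>carrier G. \<forall>g'\<in>carrier G.
        msum d (carrier G) (\<lambda>s. U g s * mat_adjoint (U g' s)) = (if g = g' then 1\<^sub>m d else 0\<^sub>m d d)) \<and>
     (\<forall>s\<in>carrier G. \<forall>s'\<in>carrier G. \<forall>g\<in>carrier G. \<forall>g'\<in>carrier G.
        E s s' g g' = mat_adjoint (U g s) * U g' s')"
    by (elim exE)
  have Uc: "U g s \<in> carrier_mat d d" if "g\<in>carrier G" "s\<in>carrier G" for g s
    using U that by blast
  have U1: "mat_sum d d (carrier G) (\<lambda>g. mat_adjoint (U g s) * U g s) = 1\<^sub>m d" if "s\<in>carrier G" for s
  proof -
    have "msum d (carrier G) (\<lambda>g. mat_adjoint (U g s) * U g s) = (if s = s then 1\<^sub>m d else 0\<^sub>m d d)"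
      using U that by blast
    then show ?thesis by (simp add: msum_eq_mat_sum)
  qed
  have U2: "mat_sum d d (carrier G) (\<lambda>s. U g s * mat_adjoint (U g s)) = 1\<^sub>m d" if "g\<in>carrier G" for g
  proof -
    have "msum d (carrier G) (\<lambda>s. U g s * mat_adjoint (U g s)) = (if g = g then 1\<^sub>m d else 0\<^sub>m d d)"
      using U that by blast
    then show ?thesis by (simp add: msum_eq_mat_sum)
  qed
  have EU: "E s s' g g' = mat_adjoint (U g s) * U g' s'"
    if "s\<in>carrier G" "s'\<in>carrier G" "g\<in>carrier G" "g'\<in>carrier G" for s s' g g'
    using U that by blast
  have U0: "U g s = 0\<^sub>m d d" if "g \<in> carrier G" "s \<in> carrier G" "g \<noteq> s" for g s
    using adjoint_mult_self_eq_0[OF Uc] EU[of s s g g] off[of s g] that by simp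
  have z: "mat_adjoint (0\<^sub>m d d :: complex mat) = 0\<^sub>m d d" by (rule eq_matI) auto
  \<comment> \<open>In each column and in each row of the block unitary only the diagonal block
    survives; the column relation gives an isometry, the row relation a co-isometry.\<close>
  have UU: "mat_adjoint (U s s) * U s s = 1\<^sub>m d" "U s s * mat_adjoint (U s s) = 1\<^sub>m d" if s: "s \<in> carrier G" for s
  proof -
    have "mat_sum d d (carrier G) (\<lambda>g. mat_adjoint (U g s) * U g s) = mat_adjoint (U s s) * U s s"
      using G s Uc[OF s s] by (intro mat_sum_single) (auto simp: U0 z)
    then show "mat_adjoint (U s s) * U s s = 1\<^sub>m d" using U1[OF s] by simp
    have "mat_sum d d (carrier G) (\<lambda>g. U s g * mat_adjoint (U s g)) = U s s * mat_adjoint (U s s)"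
      using G s Uc[OF s s] by (intro mat_sum_single) (auto simp: U0 z)
    then show "U s s * mat_adjoint (U s s) = 1\<^sub>m d" using U2[OF s] by simp
  qed
  define A where "A s = mat_adjoint (U \<one> \<one>) * U s s" for s
  have c: "U s s \<in> carrier_mat d d" "mat_adjoint (U s s) \<in> carrier_mat d d" if "s \<in> carrier G" for s
    using Uc[OF that that] by auto
  have adjA: "mat_adjoint (A s) = mat_adjoint (U s s) * U \<one> \<one>" if "s \<in> carrier G" for s
    unfolding A_def using c[OF that] c[of \<one>] by (subst mat_adjoint_mult) auto
  have AA: "mat_adjoint (A s) * A s' = mat_adjoint (U s s) * U s' s'" if s: "s \<in> carrier G" "s' \<in> carrier G" for s s'
  proof -
    have "mat_adjoint (A s) * A s' = mat_adjoint (U s s) * (U \<one> \<one> * mat_adjoint (U \<one> \<one>)) * U s' s'"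
      unfolding adjA[OF s(1)] unfolding A_def using c[OF s(1)] c[OF s(2)] c[of \<one>]
      by (simp add: assoc_mult_mat[of _ d d _ d _ d] mult_carrier_mat[of _ d d _ d])
    then show ?thesis using UU[of \<one>] c[OF s(1)] by simp
  qed
  have "A s * mat_adjoint (A s) = 1\<^sub>m d" if s: "s \<in> carrier G" for s
  proof -
    have "A s * mat_adjoint (A s) = mat_adjoint (U \<one> \<one>) * (U s s * mat_adjoint (U s s)) * U \<one> \<one>"
      unfolding adjA[OF s] unfolding A_def using c[OF s] c[of \<one>]
      by (simp add: assoc_mult_mat[of _ d d _ d _ d] mult_carrier_mat[of _ d d _ d])
    then show ?thesis using UU[OF s] UU[of \<one>] c[of \<one>] by simp
  qed
  moreover have "A s \<in> carrier_mat d d" if "s \<in> carrier G" for s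
    unfolding A_def by (rule mult_carrier_mat[OF c(2)[OF one_closed] c(1)[OF that]])
  ultimately have "unitary_in d (A s)" if "s \<in> carrier G" for s
    using AA[OF that that] UU[OF that] that by (simp add: unitary_in_def)
  moreover have "A \<one> = 1\<^sub>m d" using UU[of \<one>] by (simp add: A_def)
  moreover have "E s s' g g' = (if g = s \<and> g' = s' then mat_adjoint (A s) * A s' else 0\<^sub>m d d)"
    if m: "s \<in> carrier G" "s' \<in> carrier G" "g \<in> carrier G" "g' \<in> carrier G" for s s' g g'
  proof -
    consider "g = s" "g' = s'" | "g \<noteq> s" | "g' \<noteq> s'" by blast
    then show ?thesis
    proof cases
      case 1 then show ?thesis using EU[OF m] AA[OF m(1,2)] by simp
    next
      case 2
      then show ?thesis using EU[OF m] U0[OF m(3,1)] Uc[OF m(4,2)] by (simp add: z)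
    next
      case 3
      then show ?thesis using EU[OF m] U0[OF m(4,2)] right_mult_zero_mat[OF mat_adjoint_carrier[OF Uc[OF m(3,1)]]] by simp
    qed
  qed
  ultimately show ?thesis using that by blast
qed

section \<open>Entries of the correlation, and cancellation against a full rank vector\<close>

lemma sum_delta4:
  fixes K :: "'a \<Rightarrow> 'a \<Rightarrow> 'a \<Rightarrow> 'a \<Rightarrow> complex"
  assumes "finite A" "s \<in> A" "s' \<in> A" "t \<in> A" "t' \<in> A"
  shows "(\<Sum>a\<in>A. \<Sum>b\<in>A. \<Sum>c\<in>A. \<Sum>d\<in>A. (if (a,c) = (s,t) \<and> (b,d) = (s',t') then 1 else 0) * K a b c d)
    = K s s' t t'"
proof -
  have 1: "(\<Sum>d\<in>A. (if (a,c) = (s,t) \<and> (b,d) = (s',t') then 1 else 0) * K a b c d)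
      = (if c = t then if b = s' then if a = s then K s s' t t' else 0 else 0 else 0)" for a b c
  proof (cases "a = s \<and> b = s' \<and> c = t")
    case True
    then have "(\<Sum>d\<in>A. (if (a,c) = (s,t) \<and> (b,d) = (s',t') then 1 else 0) * K a b c d)
      = (\<Sum>d\<in>A. if d = t' then K s s' t t' else 0)"
      by (intro sum.cong refl) auto
    then show ?thesis using assms True by simp
  next
    case False
    then show ?thesis by (intro trans[OF sum.neutral]) auto
  qed
  show ?thesis unfolding 1 using assms by simp
qed

text \<open>Both channels are evaluated at the matrix unit \<open>X\<close> at ((s,t),(s',t')) and
  compared in the entry ((g,h),(g',h')). The Schur multiplier keeps a matrix unit in its place, so
  its value is zero unless all output indices equal the input indices.\<close>

lemma correlation_entry:
  fixes G (structure)
  assumes "finite (carrier G)" "gchannel_eq G (qns_corr G E F xi) (schur_channel G u)"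
    and s: "s \<in> carrier G" "s' \<in> carrier G" "g \<in> carrier G" "g' \<in> carrier G"
    and t: "t \<in> carrier G" "t' \<in> carrier G" "h \<in> carrier G" "h' \<in> carrier G"
  shows "(kron_mat (E s s' g g') (F t t' h h') *\<^sub>v xi) \<bullet>c xi
    = (if g = s \<and> g' = s' \<and> h = t \<and> h' = t' then u (inv s \<otimes> s') (inv t \<otimes> t') else 0)"
proof -
  define X :: "'a gop" where "X = (\<lambda>a b. if a = (s,t) \<and> b = (s',t') then 1 else 0)"
  have "qns_corr G E F xi X (g,h) (g',h') = schur_channel G u X (g,h) (g',h')"
    using assms(2) s t by (auto simp: gchannel_eq_def)
  moreover have "qns_corr G E F xi X (g,h) (g',h') = (kron_mat (E s s' g g') (F t t' h h') *\<^sub>v xi) \<bullet>c xi"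
    unfolding qns_corr_def X_def prod.case using assms(1) s t
    by (intro sum_delta4[of _ s s' t t' "\<lambda>a b c d. (kron_mat (E a b g g') (F c d h h') *\<^sub>v xi) \<bullet>c xi"])
  ultimately show ?thesis by (auto simp: schur_channel_def X_def)
qed

lemma invertible_mat_cancel:
  fixes M R :: "complex mat"
  assumes "invertible_mat R" "R \<in> carrier_mat m m" "M \<in> carrier_mat k m" "M * R = 0\<^sub>m k m"
  shows "M = 0\<^sub>m k m"
proof -
  obtain S where S: "R * S = 1\<^sub>m m" "S * R = 1\<^sub>m (dim_row S)"
    using assms(1,2) by (auto simp: invertible_mat_def inverts_mat_def)
  have Sc: "S \<in> carrier_mat m m"
    using arg_cong[OF S(1), of dim_col] arg_cong[OF S(2), of dim_col] assms(2) by (auto intro: carrier_matI)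
  have "M = M * (R * S)" using S assms(3) by simp
  also have "\<dots> = 0\<^sub>m k m" using assms Sc by (subst assoc_mult_mat[of _ k m _ m _ m, symmetric]) auto
  finally show ?thesis .
qed

text \<open>Let X be the m by n coefficient matrix of \<open>xi\<close>. Then (M \<otimes> 1)\<xi>
  has coefficient matrix M X, while the reduced density is X times its adjoint. So M X = 0 makes
  \<open>M\<close> times the reduced density vanish, and the latter is invertible.\<close>

lemma full_rank_left:
  assumes "xi \<in> carrier_vec (m*n)" "invertible_mat (ptrace_2 m n (outer xi))" "M \<in> carrier_mat k m"
    and "kron_mat M (1\<^sub>m n) *\<^sub>v xi = 0\<^sub>v (k*n)"
  shows "M = 0\<^sub>m k m"
proof -
  let ?R = "ptrace_2 m n (outer xi)"
  have z: "(\<Sum>a<m. M $$ (i,a) * xi $ (a*n+j)) = 0" if "i < k" "j < n" for i j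
  proof -
    have "(kron_mat M (1\<^sub>m n) *\<^sub>v xi) $ (i*n+j) = (\<Sum>a<m. \<Sum>b<n. M $$ (i,a) * 1\<^sub>m n $$ (j,b) * xi $ (a*n+b))"
      using assms(1,3) that by (intro kron_mat_mult_vec_index) auto
    also have "\<dots> = (\<Sum>a<m. \<Sum>b<n. if b = j then M $$ (i,a) * xi $ (a*n+b) else 0)"
      using that by (intro sum.cong refl) auto
    finally have "(kron_mat M (1\<^sub>m n) *\<^sub>v xi) $ (i*n+j) = (\<Sum>a<m. \<Sum>b<n. if b = j then M $$ (i,a) * xi $ (a*n+b) else 0)" .
    then show ?thesis using assms(4) that by (simp add: pair_index_less)
  qed
  have "M * ?R = 0\<^sub>m k m"
  proof (rule eq_matI)
    fix i j assume "i < dim_row (0\<^sub>m k m :: complex mat)" "j < dim_col (0\<^sub>m k m :: complex mat)"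
    then have ij: "i < k" "j < m" by auto
    have "(M * ?R) $$ (i,j) = (\<Sum>a<m. \<Sum>b<n. M $$ (i,a) * xi $ (a*n+b) * cnj (xi $ (j*n+b)))"
    proof -
      have "?R $$ (a,j) = (\<Sum>b<n. xi $ (a*n+b) * cnj (xi $ (j*n+b)))" if "a < m" for a
        using assms(1) ij that by (simp add: ptrace_2_def outer_def pair_index_less)
      moreover have "(M * ?R) $$ (i,j) = (\<Sum>a<m. M $$ (i,a) * ?R $$ (a,j))"
        by (rule mult_mat_index[OF assms(3) _ ij]) (simp add: ptrace_2_def)
      ultimately show ?thesis by (simp add: sum_distrib_left mult.assoc)
    qed
    also have "\<dots> = (\<Sum>b<n. (\<Sum>a<m. M $$ (i,a) * xi $ (a*n+b)) * cnj (xi $ (j*n+b)))"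
      by (subst sum.swap) (simp add: sum_distrib_right)
    finally show "(M * ?R) $$ (i,j) = 0\<^sub>m k m $$ (i,j)" using ij by (simp add: z)
  qed (use assms(3) in \<open>simp_all add: ptrace_2_def\<close>)
  from invertible_mat_cancel[OF assms(2) _ assms(3) this] show ?thesis by (simp add: ptrace_2_def)
qed

text \<open>The mirror image with the transposed coefficient matrix: if Y is the transpose of X, the
  vector corresponds to M Y, and the reduced density is Y times its adjoint.\<close>

lemma full_rank_right:
  assumes "xi \<in> carrier_vec (m*n)" "invertible_mat (ptrace_1 m n (outer xi))" "M \<in> carrier_mat k n"
    and "kron_mat (1\<^sub>m m) M *\<^sub>v xi = 0\<^sub>v (m*k)"
  shows "M = 0\<^sub>m k n"
proof -
  let ?R = "ptrace_1 m n (outer xi)"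
  have z: "(\<Sum>b<n. M $$ (j,b) * xi $ (i*n+b)) = 0" if "i < m" "j < k" for i j
  proof -
    have "(kron_mat (1\<^sub>m m) M *\<^sub>v xi) $ (i*k+j) = (\<Sum>a<m. \<Sum>b<n. 1\<^sub>m m $$ (i,a) * M $$ (j,b) * xi $ (a*n+b))"
      using assms(1,3) that by (intro kron_mat_mult_vec_index) auto
    also have "\<dots> = (\<Sum>a<m. if a = i then \<Sum>b<n. M $$ (j,b) * xi $ (a*n+b) else 0)"
      using that by (intro sum.cong refl) auto
    finally have "(kron_mat (1\<^sub>m m) M *\<^sub>v xi) $ (i*k+j) = (\<Sum>a<m. if a = i then \<Sum>b<n. M $$ (j,b) * xi $ (a*n+b) else 0)" .
    then show ?thesis using assms(4) that by (simp add: pair_index_less)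
  qed
  have "M * ?R = 0\<^sub>m k n"
  proof (rule eq_matI)
    fix i j assume "i < dim_row (0\<^sub>m k n :: complex mat)" "j < dim_col (0\<^sub>m k n :: complex mat)"
    then have ij: "i < k" "j < n" by auto
    have "(M * ?R) $$ (i,j) = (\<Sum>b<n. \<Sum>a<m. M $$ (i,b) * xi $ (a*n+b) * cnj (xi $ (a*n+j)))"
    proof -
      have "?R $$ (b,j) = (\<Sum>a<m. xi $ (a*n+b) * cnj (xi $ (a*n+j)))" if "b < n" for b
        using assms(1) ij that by (simp add: ptrace_1_def outer_def pair_index_less)
      moreover have "(M * ?R) $$ (i,j) = (\<Sum>b<n. M $$ (i,b) * ?R $$ (b,j))"
        by (rule mult_mat_index[OF assms(3) _ ij]) (simp add: ptrace_1_def)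
      ultimately show ?thesis by (simp add: sum_distrib_left mult.assoc)
    qed
    also have "\<dots> = (\<Sum>a<m. (\<Sum>b<n. M $$ (i,b) * xi $ (a*n+b)) * cnj (xi $ (a*n+j)))"
      by (subst sum.swap) (simp add: sum_distrib_right)
    finally show "(M * ?R) $$ (i,j) = 0\<^sub>m k n $$ (i,j)" using ij by (simp add: z)
  qed (use assms(3) in \<open>simp_all add: ptrace_1_def\<close>)
  from invertible_mat_cancel[OF assms(2) _ assms(3) this] show ?thesis by (simp add: ptrace_1_def)
qed

section \<open>Inner products of vectors (A \<otimes> B)v and vanishing of off-diagonal
  blocks\<close>

lemma mat_sum_mult_vec_index:
  assumes "\<And>k. k \<in> I \<Longrightarrow> f k \<in> carrier_mat m n" "v \<in> carrier_vec n" "i < m"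
  shows "(mat_sum m n I f *\<^sub>v v) $ i = (\<Sum>k\<in>I. (f k *\<^sub>v v) $ i)"
proof -
  have "(mat_sum m n I f *\<^sub>v v) $ i = (\<Sum>j<n. \<Sum>k\<in>I. f k $$ (i,j) * v $ j)"
    using assms(2,3) by (simp add: scalar_prod_def atLeast0LessThan sum_distrib_right)
  also have "\<dots> = (\<Sum>k\<in>I. \<Sum>j<n. f k $$ (i,j) * v $ j)" by (rule sum.swap)
  also have "\<dots> = (\<Sum>k\<in>I. (f k *\<^sub>v v) $ i)"
  proof (intro sum.cong refl)
    fix k assume "k \<in> I"
    from assms(1)[OF this] show "(\<Sum>j<n. f k $$ (i,j) * v $ j) = (f k *\<^sub>v v) $ i"
      using assms(2,3) by (simp add: scalar_prod_def atLeast0LessThan)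
  qed
  finally show ?thesis .
qed

lemma smult_mat_mult_vec:
  fixes A :: "complex mat"
  assumes "A \<in> carrier_mat m n" "v \<in> carrier_vec n"
  shows "(c \<cdot>\<^sub>m A) *\<^sub>v v = c \<cdot>\<^sub>v (A *\<^sub>v v)"
  using assms by (intro eq_vecI) (simp_all add: scalar_prod_def sum_distrib_left mult.assoc)

lemma cscalar_mat_sum_mult_vec:
  assumes "\<And>k. k \<in> I \<Longrightarrow> f k \<in> carrier_mat m n" "v \<in> carrier_vec n" "w \<in> carrier_vec m"
  shows "(mat_sum m n I f *\<^sub>v v) \<bullet>c w = (\<Sum>k\<in>I. (f k *\<^sub>v v) \<bullet>c w)"
proof -
  have "(mat_sum m n I f *\<^sub>v v) \<bullet>c w = (\<Sum>i<m. \<Sum>k\<in>I. (f k *\<^sub>v v) $ i * cnj (w $ i))"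
    using assms
    by (simp add: cscalar_eq_sum[OF mult_mat_vec_carrier[OF mat_sum_carrier]] mat_sum_mult_vec_index[of _ _ m n]
        sum_distrib_right del: index_mult_mat_vec)
  also have "\<dots> = (\<Sum>k\<in>I. \<Sum>i<m. (f k *\<^sub>v v) $ i * cnj (w $ i))" by (rule sum.swap)
  also have "\<dots> = (\<Sum>k\<in>I. (f k *\<^sub>v v) \<bullet>c w)"
    by (intro sum.cong refl cscalar_eq_sum[symmetric] mult_mat_vec_carrier[OF assms(1)] assms(2,3))
  finally show ?thesis .
qed

text \<open>Moving the second operator to the left as an adjoint produces products of the form in
  which USOM entries are given, so Gram matrices of such vectors become correlation values.\<close>

lemma kron_gram:
  assumes "A \<in> carrier_mat k m" "A' \<in> carrier_mat k m" "B \<in> carrier_mat l n" "B' \<in> carrier_mat l n"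
    and "v \<in> carrier_vec (m*n)"
  shows "(kron_mat A B *\<^sub>v v) \<bullet>c (kron_mat A' B' *\<^sub>v v)
    = (kron_mat (mat_adjoint A' * A) (mat_adjoint B' * B) *\<^sub>v v) \<bullet>c v"
proof -
  have c: "kron_mat A B \<in> carrier_mat (k*l) (m*n)" "kron_mat A' B' \<in> carrier_mat (k*l) (m*n)"
    "mat_adjoint (kron_mat A' B') \<in> carrier_mat (m*n) (k*l)"
    using assms by auto
  have "(kron_mat A B *\<^sub>v v) \<bullet>c (kron_mat A' B' *\<^sub>v v)
      = (mat_adjoint (kron_mat A' B') *\<^sub>v (kron_mat A B *\<^sub>v v)) \<bullet>c v"
    using cscalar_mult_mat_vec[OF c(3) mult_mat_vec_carrier[OF c(1) assms(5)] assms(5)] by simp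
  also have "mat_adjoint (kron_mat A' B') *\<^sub>v (kron_mat A B *\<^sub>v v)
      = (mat_adjoint (kron_mat A' B') * kron_mat A B) *\<^sub>v v"
    by (rule assoc_mult_mat_vec[OF c(3) c(1) assms(5), symmetric])
  also have "mat_adjoint (kron_mat A' B') * kron_mat A B
      = kron_mat (mat_adjoint A' * A) (mat_adjoint B' * B)"
    unfolding mat_adjoint_kron
    by (rule kron_mat_mult[OF mat_adjoint_carrier[OF assms(2)] mat_adjoint_carrier[OF assms(4)] assms(1,3)])
  finally show ?thesis .
qed

text \<open>Write the entry as U adjoint times U. The squared norm of (U \<otimes> 1)\<xi> is its
  expectation with the identity on the other side, and the identity is the sum over \<open>h\<close>
  of the entries of \<open>F\<close> at a fixed input, for which the group unit is taken. Every
  summand is zero by hypothesis, and full rank gives U = 0.\<close>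

lemma usom_off_diagonal_left:
  fixes G (structure)
  assumes G: "group G" "finite (carrier G)" and E: "usom G m E" and F: "usom G n F"
    and xi: "xi \<in> carrier_vec (m*n)" "invertible_mat (ptrace_2 m n (outer xi))"
    and corr: "\<And>h. h \<in> carrier G \<Longrightarrow> (kron_mat (E s s g g) (F \<one> \<one> h h) *\<^sub>v xi) \<bullet>c xi = 0"
    and sg: "s \<in> carrier G" "g \<in> carrier G"
  shows "E s s g g = 0\<^sub>m m m"
proof -
  interpret group G by (rule G)
  obtain U where U: "U \<in> carrier_mat m m" "E s s g g = mat_adjoint U * U"
    using usom_diag_square[OF E sg] .
  have Ec: "E s s g g \<in> carrier_mat m m" unfolding U(2) by (rule mult_carrier_mat[OF mat_adjoint_carrier[OF U(1)] U(1)])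
  have Fc: "F \<one> \<one> h h \<in> carrier_mat n n" if "h \<in> carrier G" for h
    using usom_diag_square[OF F one_closed that] by (metis mat_adjoint_carrier mult_carrier_mat)
  have "(kron_mat U (1\<^sub>m n) *\<^sub>v xi) \<bullet>c (kron_mat U (1\<^sub>m n) *\<^sub>v xi)
      = (kron_mat (E s s g g) (1\<^sub>m n) *\<^sub>v xi) \<bullet>c xi"
    unfolding U(2) using kron_gram[OF U(1) U(1) one_carrier_mat one_carrier_mat xi(1)] by simp
  also have "\<dots> = (mat_sum (m*n) (m*n) (carrier G) (\<lambda>h. kron_mat (E s s g g) (F \<one> \<one> h h)) *\<^sub>v xi) \<bullet>c xi"
    unfolding usom_sum_diag[OF F one_closed, symmetric] by (simp add: kron_mat_sum_right[OF Ec] Fc)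
  also have "\<dots> = (\<Sum>h\<in>carrier G. (kron_mat (E s s g g) (F \<one> \<one> h h) *\<^sub>v xi) \<bullet>c xi)"
    by (rule cscalar_mat_sum_mult_vec[OF kron_mat_carrier[OF Ec Fc] xi(1) xi(1)])
  also have "\<dots> = 0" by (simp add: corr)
  finally have "kron_mat U (1\<^sub>m n) *\<^sub>v xi = 0\<^sub>v (m*n)"
    using mult_mat_vec_carrier[OF kron_mat_carrier[OF U(1) one_carrier_mat] xi(1)]
    by (intro iffD1[OF conjugate_square_eq_0_vec])
  from full_rank_left[OF xi U(1) this] show ?thesis unfolding U(2) by (simp add: right_mult_zero_mat[of _ m m])
qed

lemma usom_off_diagonal_right:
  fixes G (structure)
  assumes G: "group G" "finite (carrier G)" and E: "usom G m E" and F: "usom G n F"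
    and xi: "xi \<in> carrier_vec (m*n)" "invertible_mat (ptrace_1 m n (outer xi))"
    and corr: "\<And>g. g \<in> carrier G \<Longrightarrow> (kron_mat (E \<one> \<one> g g) (F t t h h) *\<^sub>v xi) \<bullet>c xi = 0"
    and th: "t \<in> carrier G" "h \<in> carrier G"
  shows "F t t h h = 0\<^sub>m n n"
proof -
  interpret group G by (rule G)
  obtain U where U: "U \<in> carrier_mat n n" "F t t h h = mat_adjoint U * U"
    using usom_diag_square[OF F th] .
  have Fc: "F t t h h \<in> carrier_mat n n" unfolding U(2) by (rule mult_carrier_mat[OF mat_adjoint_carrier[OF U(1)] U(1)])
  have Ec: "E \<one> \<one> g g \<in> carrier_mat m m" if "g \<in> carrier G" for g
    using usom_diag_square[OF E one_closed that] by (metis mat_adjoint_carrier mult_carrier_mat)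
  have "(kron_mat (1\<^sub>m m) U *\<^sub>v xi) \<bullet>c (kron_mat (1\<^sub>m m) U *\<^sub>v xi)
      = (kron_mat (1\<^sub>m m) (F t t h h) *\<^sub>v xi) \<bullet>c xi"
    unfolding U(2) using kron_gram[OF one_carrier_mat one_carrier_mat U(1) U(1) xi(1)] by simp
  also have "\<dots> = (mat_sum (m*n) (m*n) (carrier G) (\<lambda>g. kron_mat (E \<one> \<one> g g) (F t t h h)) *\<^sub>v xi) \<bullet>c xi"
    unfolding usom_sum_diag[OF E one_closed, symmetric] by (simp add: kron_mat_sum_left[OF Fc] Ec)
  also have "\<dots> = (\<Sum>g\<in>carrier G. (kron_mat (E \<one> \<one> g g) (F t t h h) *\<^sub>v xi) \<bullet>c xi)"
    by (rule cscalar_mat_sum_mult_vec[OF kron_mat_carrier[OF Ec Fc] xi(1) xi(1)])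
  also have "\<dots> = 0" by (simp add: corr)
  finally have "kron_mat (1\<^sub>m m) U *\<^sub>v xi = 0\<^sub>v (m*n)"
    using mult_mat_vec_carrier[OF kron_mat_carrier[OF one_carrier_mat U(1)] xi(1)]
    by (intro iffD1[OF conjugate_square_eq_0_vec])
  from full_rank_right[OF xi U(1) this] show ?thesis unfolding U(2) by (simp add: right_mult_zero_mat[of _ n n])
qed

text \<open>The definition of \<open>unitary_rep\<close> asks for unitarity and multiplicativity
  only; the value at the group unit is an idempotent unitary, hence the identity.\<close>

lemma unitary_rep_one:
  fixes G (structure)
  assumes "group G" "unitary_rep G d p"
  shows "p \<one> = 1\<^sub>m d"
proof -
  interpret group G by fact
  have p: "p \<one> \<in> carrier_mat d d" "mat_adjoint (p \<one>) * p \<one> = 1\<^sub>m d" "p \<one> * p \<one> = p \<one>"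
    using assms(2) by (auto simp: unitary_rep_def unitary_in_def) (metis one_closed l_one)
  have "p \<one> = mat_adjoint (p \<one>) * p \<one> * p \<one>" using p by simp
  also have "\<dots> = mat_adjoint (p \<one>) * (p \<one> * p \<one>)"
    by (rule assoc_mult_mat[OF mat_adjoint_carrier[OF p(1)] p(1) p(1)])
  finally show ?thesis using p by simp
qed

text \<open>This brings the blocks of \<open>rep_usom\<close> into the same shape, adjoint of X_s
  times X_s', that the blocks of a diagonal USOM have.\<close>

lemma unitary_rep_inv_mult:
  fixes G (structure)
  assumes "group G" "unitary_rep G d p" "s \<in> carrier G" "t \<in> carrier G"
  shows "p (inv s \<otimes> t) = mat_adjoint (p s) * p t"
proof -
  interpret group G by fact
  have p: "p x \<in> carrier_mat d d" "mat_adjoint (p x) * p x = 1\<^sub>m d" if "x \<in> carrier G" for x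
    using assms(2) that by (auto simp: unitary_rep_def unitary_in_def)
  have h: "p (x \<otimes> y) = p x * p y" if "x \<in> carrier G" "y \<in> carrier G" for x y
    using assms(2) that by (simp add: unitary_rep_def)
  have st: "inv s \<otimes> t \<in> carrier G" using assms by simp
  have "mat_adjoint (p s) * p t = mat_adjoint (p s) * (p s * p (inv s \<otimes> t))"
    using h[of s "inv s \<otimes> t"] assms by (simp add: m_assoc[symmetric])
  also have "\<dots> = mat_adjoint (p s) * p s * p (inv s \<otimes> t)"
    by (rule assoc_mult_mat[OF mat_adjoint_carrier[OF p(1)[OF assms(3)]] p(1)[OF assms(3)] p(1)[OF st], symmetric])
  finally show ?thesis using p[OF assms(3)] p(1)[OF st] by simp
qed

section \<open>Operators are determined by their values on the orbit of a marginally cyclic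
  vector\<close>

lemma mult_vec_eq_on_mat_sum:
  assumes M: "M \<in> carrier_mat k m" "M' \<in> carrier_mat k m"
    and K: "\<And>t. t \<in> I \<Longrightarrow> K t \<in> carrier_mat m n" and v: "v \<in> carrier_vec n"
    and eq: "\<And>t. t \<in> I \<Longrightarrow> M *\<^sub>v (K t *\<^sub>v v) = M' *\<^sub>v (K t *\<^sub>v v)"
  shows "M *\<^sub>v (mat_sum m n I (\<lambda>t. c t \<cdot>\<^sub>m K t) *\<^sub>v v) = M' *\<^sub>v (mat_sum m n I (\<lambda>t. c t \<cdot>\<^sub>m K t) *\<^sub>v v)"
proof -
  have cK: "c t \<cdot>\<^sub>m K t \<in> carrier_mat m n" if "t \<in> I" for t using K[OF that] by simp
  have key: "(N *\<^sub>v (mat_sum m n I (\<lambda>t. c t \<cdot>\<^sub>m K t) *\<^sub>v v)) $ i = (\<Sum>t\<in>I. (c t \<cdot>\<^sub>v (N *\<^sub>v (K t *\<^sub>v v))) $ i)"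
    if N: "N \<in> carrier_mat k m" and i: "i < k" for N i
  proof -
    have "N *\<^sub>v (mat_sum m n I (\<lambda>t. c t \<cdot>\<^sub>m K t) *\<^sub>v v) = mat_sum k n I (\<lambda>t. N * (c t \<cdot>\<^sub>m K t)) *\<^sub>v v"
      by (simp add: assoc_mult_mat_vec[OF N mat_sum_carrier v, symmetric] mult_mat_sum[OF N] cK)
    then have "(N *\<^sub>v (mat_sum m n I (\<lambda>t. c t \<cdot>\<^sub>m K t) *\<^sub>v v)) $ i = (\<Sum>t\<in>I. ((N * (c t \<cdot>\<^sub>m K t)) *\<^sub>v v) $ i)"
      by (simp only: mat_sum_mult_vec_index[OF mult_carrier_mat[OF N cK] v i])
    also have "\<dots> = (\<Sum>t\<in>I. (c t \<cdot>\<^sub>v (N *\<^sub>v (K t *\<^sub>v v))) $ i)"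
    proof (intro sum.cong refl)
      fix t assume t: "t \<in> I"
      show "((N * (c t \<cdot>\<^sub>m K t)) *\<^sub>v v) $ i = (c t \<cdot>\<^sub>v (N *\<^sub>v (K t *\<^sub>v v))) $ i"
        using mult_smult_distrib[OF N K[OF t]] smult_mat_mult_vec[OF mult_carrier_mat[OF N K[OF t]] v]
          assoc_mult_mat_vec[OF N K[OF t] v] by simp
    qed
    finally show ?thesis .
  qed
  show ?thesis
  proof (rule eq_vecI)
    fix i assume "i < dim_vec (M' *\<^sub>v (mat_sum m n I (\<lambda>t. c t \<cdot>\<^sub>m K t) *\<^sub>v v))"
    then have i: "i < k" using M by simp
    show "(M *\<^sub>v (mat_sum m n I (\<lambda>t. c t \<cdot>\<^sub>m K t) *\<^sub>v v)) $ i
        = (M' *\<^sub>v (mat_sum m n I (\<lambda>t. c t \<cdot>\<^sub>m K t) *\<^sub>v v)) $ i"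
      unfolding key[OF M(1) i] key[OF M(2) i] by (intro sum.cong refl) (simp only: eq)
  qed (use M in simp)
qed

text \<open>The orbit spans: cyclicity writes any vector as (B \<otimes> 1)\<psi>, and
  irreducibility makes \<open>B\<close> a combination of the \<open>r t\<close>.\<close>

lemma mat_eq_on_left_orbit:
  fixes G (structure)
  assumes G: "group G" "finite (carrier G)" and r: "irreducible_rep G m r" "unitary_rep G m r"
    and psi: "marginally_cyclic m n psi"
    and M: "M \<in> carrier_mat k (m*n)" "M' \<in> carrier_mat k (m*n)"
    and eq: "\<And>t. t \<in> carrier G \<Longrightarrow> M *\<^sub>v (kron_mat (r t) (1\<^sub>m n) *\<^sub>v psi) = M' *\<^sub>v (kron_mat (r t) (1\<^sub>m n) *\<^sub>v psi)"
  shows "M = M'"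
proof (rule mat_eqI_mult_vec[OF M])
  fix v :: "complex vec" assume "v \<in> carrier_vec (m*n)"
  then obtain B where B: "B \<in> carrier_mat m m" "v = kron_mat (B) (1\<^sub>m n) *\<^sub>v psi"
    using psi unfolding marginally_cyclic_def by blast
  have psic: "psi \<in> carrier_vec (m*n)" using psi by (simp add: marginally_cyclic_def)
  have rc: "r t \<in> carrier_mat m m" if "t \<in> carrier G" for t
    using r(2) that by (auto simp: unitary_rep_def unitary_in_def)
  obtain c where c: "B = mat_sum m m (carrier G) (\<lambda>t. c t \<cdot>\<^sub>m r t)"
    using rep_span[OF G r B(1)] .
  have "v = mat_sum (m*n) (m*n) (carrier G) (\<lambda>t. c t \<cdot>\<^sub>m kron_mat (r t) (1\<^sub>m n)) *\<^sub>v psi"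
    unfolding B(2) c using rc by (subst kron_mat_sum_left) (auto simp: kron_mat_smult_left)
  then show "M *\<^sub>v v = M' *\<^sub>v v"
    using mult_vec_eq_on_mat_sum[OF M _ psic eq, where I = "carrier G" and c = c] rc by simp
qed

lemma mat_eq_on_right_orbit:
  fixes G (structure)
  assumes G: "group G" "finite (carrier G)" and r: "irreducible_rep G n r" "unitary_rep G n r"
    and psi: "marginally_cyclic m n psi"
    and M: "M \<in> carrier_mat k (m*n)" "M' \<in> carrier_mat k (m*n)"
    and eq: "\<And>t. t \<in> carrier G \<Longrightarrow> M *\<^sub>v (kron_mat (1\<^sub>m m) (r t) *\<^sub>v psi) = M' *\<^sub>v (kron_mat (1\<^sub>m m) (r t) *\<^sub>v psi)"
  shows "M = M'"
proof (rule mat_eqI_mult_vec[OF M])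
  fix v :: "complex vec" assume "v \<in> carrier_vec (m*n)"
  then obtain B where B: "B \<in> carrier_mat n n" "v = kron_mat (1\<^sub>m m) (B) *\<^sub>v psi"
    using psi unfolding marginally_cyclic_def by blast
  have psic: "psi \<in> carrier_vec (m*n)" using psi by (simp add: marginally_cyclic_def)
  have rc: "r t \<in> carrier_mat n n" if "t \<in> carrier G" for t
    using r(2) that by (auto simp: unitary_rep_def unitary_in_def)
  obtain c where c: "B = mat_sum n n (carrier G) (\<lambda>t. c t \<cdot>\<^sub>m r t)"
    using rep_span[OF G r B(1)] .
  have "v = mat_sum (m*n) (m*n) (carrier G) (\<lambda>t. c t \<cdot>\<^sub>m kron_mat (1\<^sub>m m) (r t)) *\<^sub>v psi"
    unfolding B(2) c using rc by (subst kron_mat_sum_right) (auto simp: kron_mat_smult_right)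
  then show "M *\<^sub>v v = M' *\<^sub>v v"
    using mult_vec_eq_on_mat_sum[OF M _ psic eq, where I = "carrier G" and c = c] rc by simp
qed

section \<open>Intertwining isometries\<close>

lemma intertwine_mult:
  fixes W :: "complex mat"
  assumes W: "W \<in> carrier_mat N n" and c: "K \<in> carrier_mat N N" "K' \<in> carrier_mat N N" "L \<in> carrier_mat n n" "L' \<in> carrier_mat n n"
    and eq: "K * W = W * L" "K' * W = W * L'"
  shows "(K * K') * W = W * (L * L')"
proof -
  have "(K * K') * W = K * (K' * W)" by (rule assoc_mult_mat[OF c(1,2) W])
  also have "\<dots> = K * W * L'" unfolding eq(2) by (rule assoc_mult_mat[OF c(1) W c(4), symmetric])
  also have "\<dots> = W * (L * L')" unfolding eq(1) by (rule assoc_mult_mat[OF W c(3,4)])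
  finally show ?thesis .
qed

text \<open>Taking adjoints of the hypothesis would give a relation for the adjoint of
  \<open>W\<close> instead. With \<open>K\<close> and \<open>L\<close> unitary one multiplies by
  their adjoints, on the left and on the right respectively, and \<open>W\<close> itself
  stays.\<close>

lemma intertwine_adjoint:
  fixes W :: "complex mat"
  assumes W: "W \<in> carrier_mat N n" and K: "unitary_in N K" and L: "unitary_in n L" and eq: "K * W = W * L"
  shows "mat_adjoint K * W = W * mat_adjoint L"
proof -
  have c: "K \<in> carrier_mat N N" "L \<in> carrier_mat n n" "mat_adjoint K \<in> carrier_mat N N" "mat_adjoint L \<in> carrier_mat n n"
    and u: "mat_adjoint K * K = 1\<^sub>m N" "L * mat_adjoint L = 1\<^sub>m n"
    using K L by (auto simp: unitary_in_def)
  have "mat_adjoint K * W = mat_adjoint K * (W * (L * mat_adjoint L))" using u(2) W by simp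
  also have "\<dots> = mat_adjoint K * (K * W * mat_adjoint L)" unfolding eq using assoc_mult_mat[OF W c(2,4)] by simp
  also have "\<dots> = mat_adjoint K * K * W * mat_adjoint L"
    using assoc_mult_mat[OF c(3) mult_carrier_mat[OF c(1) W] c(4)] assoc_mult_mat[OF c(3,1) W] by simp
  also have "\<dots> = W * mat_adjoint L" using u(1) W by simp
  finally show ?thesis .
qed

lemma kron_mat_split:
  assumes "X \<in> carrier_mat m m" "Y \<in> carrier_mat n n"
  shows "kron_mat X Y = kron_mat X (1\<^sub>m n) * kron_mat (1\<^sub>m m) Y"
  using kron_mat_mult[OF assms(1) one_carrier_mat one_carrier_mat assms(2)] assms by simp

lemma intertwine_kron:
  fixes W :: "complex mat"
  assumes W: "W \<in> carrier_mat (a*b) (p*r)"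
    and c: "X \<in> carrier_mat a a" "X' \<in> carrier_mat p p" "Y \<in> carrier_mat b b" "Y' \<in> carrier_mat r r"
    and eq: "kron_mat X (1\<^sub>m b) * W = W * kron_mat X' (1\<^sub>m r)" "kron_mat (1\<^sub>m a) Y * W = W * kron_mat (1\<^sub>m p) Y'"
  shows "kron_mat X Y * W = W * kron_mat X' Y'"
  unfolding kron_mat_split[OF c(1,3)] kron_mat_split[OF c(2,4)]
  by (rule intertwine_mult[OF W _ _ _ _ eq]) (use c in auto)

lemma intertwine_sum:
  fixes W :: "complex mat"
  assumes W: "W \<in> carrier_mat N n"
    and K: "\<And>s. s \<in> I \<Longrightarrow> K s \<in> carrier_mat N N" and L: "\<And>s. s \<in> I \<Longrightarrow> L s \<in> carrier_mat n n"
    and eq: "\<And>s. s \<in> I \<Longrightarrow> K s * W = W * L s"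
  shows "mat_sum N N I (\<lambda>s. c s \<cdot>\<^sub>m K s) * W = W * mat_sum n n I (\<lambda>s. c s \<cdot>\<^sub>m L s)"
proof -
  have cK: "c s \<cdot>\<^sub>m K s \<in> carrier_mat N N" "c s \<cdot>\<^sub>m L s \<in> carrier_mat n n" if "s \<in> I" for s
    using K[OF that] L[OF that] by auto
  have "mat_sum N N I (\<lambda>s. c s \<cdot>\<^sub>m K s) * W = mat_sum N n I (\<lambda>s. (c s \<cdot>\<^sub>m K s) * W)"
    by (rule mat_sum_mult[OF W cK(1)])
  also have "\<dots> = mat_sum N n I (\<lambda>s. W * (c s \<cdot>\<^sub>m L s))"
  proof (rule mat_sum_cong)
    fix s assume s: "s \<in> I"
    show "(c s \<cdot>\<^sub>m K s) * W = W * (c s \<cdot>\<^sub>m L s)"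
      using mult_smult_assoc_mat[OF K[OF s] W] mult_smult_distrib[OF W L[OF s]] eq[OF s] by simp
  qed
  also have "\<dots> = W * mat_sum n n I (\<lambda>s. c s \<cdot>\<^sub>m L s)"
    by (rule mult_mat_sum[OF W cK(2), symmetric])
  finally show ?thesis .
qed

lemma intertwine_sum_left:
  fixes W :: "complex mat"
  assumes W: "W \<in> carrier_mat (a*b) (p*r)"
    and A: "\<And>s. s \<in> I \<Longrightarrow> A s \<in> carrier_mat a a" and L: "\<And>s. s \<in> I \<Longrightarrow> L s \<in> carrier_mat p p"
    and eq: "\<And>s. s \<in> I \<Longrightarrow> kron_mat (A s) (1\<^sub>m b) * W = W * kron_mat (L s) (1\<^sub>m r)"
  shows "kron_mat (mat_sum a a I (\<lambda>s. c s \<cdot>\<^sub>m A s)) (1\<^sub>m b) * W = W * kron_mat (mat_sum p p I (\<lambda>s. c s \<cdot>\<^sub>m L s)) (1\<^sub>m r)"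
  using intertwine_sum[OF W _ _ eq, where I = I and c = c] A L
  by (simp add: kron_mat_sum_left[OF one_carrier_mat] kron_mat_smult_left)

lemma intertwine_sum_right:
  fixes W :: "complex mat"
  assumes W: "W \<in> carrier_mat (a*b) (p*r)"
    and A: "\<And>s. s \<in> I \<Longrightarrow> A s \<in> carrier_mat b b" and L: "\<And>s. s \<in> I \<Longrightarrow> L s \<in> carrier_mat r r"
    and eq: "\<And>s. s \<in> I \<Longrightarrow> kron_mat (1\<^sub>m a) (A s) * W = W * kron_mat (1\<^sub>m p) (L s)"
  shows "kron_mat (1\<^sub>m a) (mat_sum b b I (\<lambda>s. c s \<cdot>\<^sub>m A s)) * W = W * kron_mat (1\<^sub>m p) (mat_sum r r I (\<lambda>s. c s \<cdot>\<^sub>m L s))"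
  using intertwine_sum[OF W _ _ eq, where I = I and c = c] A L
  by (simp add: kron_mat_sum_right[OF one_carrier_mat] kron_mat_smult_right)

text \<open>The summand is e_ii, because the adjoint of e_0i is e_i0. Positivity of \<open>d\<close>
  ensures that row 0 exists.\<close>

lemma mat_sum_adjoint_mat_unit:
  assumes "0 < d"
  shows "mat_sum d d {..<d} (\<lambda>i. mat_adjoint (mat_unit d 0 i) * mat_unit d 0 i) = 1\<^sub>m d"
proof (rule eq_matI)
  fix x y assume "x < dim_row (1\<^sub>m d :: complex mat)" "y < dim_col (1\<^sub>m d :: complex mat)"
  then have xy: "x < d" "y < d" by auto
  have "(mat_adjoint (mat_unit d 0 i) * mat_unit d 0 i) $$ (x,y) = (if i = x then if x = y then 1 else 0 else 0)" for i
  proof -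
    have "(mat_adjoint (mat_unit d 0 i) * mat_unit d 0 i) $$ (x,y)
      = (\<Sum>k<d. mat_adjoint (mat_unit d 0 i) $$ (x,k) * mat_unit d 0 i $$ (k,y))"
      using xy by (intro mult_mat_index[OF mat_adjoint_carrier[OF mat_unit_carrier] mat_unit_carrier])
    also have "\<dots> = (\<Sum>k<d. if k = 0 then if i = x then if x = y then 1 else 0 else 0 else 0)"
      using xy carrier_matD[OF mat_unit_carrier[of d 0 i]] by (intro sum.cong refl) auto
    finally show ?thesis using assms by simp
  qed
  then show "mat_sum d d {..<d} (\<lambda>i. mat_adjoint (mat_unit d 0 i) * mat_unit d 0 i) $$ (x,y) = 1\<^sub>m d $$ (x,y)"
    using xy by simp
qed auto

lemma kron_mat_minus_left:
  assumes "A \<in> carrier_mat m n" "B \<in> carrier_mat m n" "C \<in> carrier_mat k l"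
  shows "kron_mat (A - B) C = kron_mat A C - kron_mat B C"
  by (rule eq_mat_pairI[of _ m k n l])
    (use assms in \<open>simp_all add: pair_index_less minus_carrier_mat kron_mat_index[of _ m n _ k l] left_diff_distrib right_diff_distrib\<close>)

lemma kron_mat_minus_right:
  assumes "A \<in> carrier_mat m n" "B \<in> carrier_mat m n" "C \<in> carrier_mat k l"
  shows "kron_mat C (A - B) = kron_mat C A - kron_mat C B"
  by (rule eq_mat_pairI[of _ k m l n])
    (use assms in \<open>simp_all add: pair_index_less minus_carrier_mat kron_mat_index[of _ k l _ m n] left_diff_distrib right_diff_distrib\<close>)

text \<open>The operator \<open>v \<mapsto> \<Sum>\<^sub>i e\<^sub>i \<otimes> P i v\<close>.\<close>

definition stack_mat :: "nat \<Rightarrow> nat \<Rightarrow> (nat \<Rightarrow> complex mat) \<Rightarrow> complex mat" where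
  "stack_mat d a P = mat (d*a) a (\<lambda>(x,k). P (x div a) $$ (x mod a, k))"

lemma stack_mat_carrier [simp]: "stack_mat d a P \<in> carrier_mat (d*a) a"
  by (simp add: stack_mat_def)

lemma stack_mat_index [simp]:
  "i < d \<Longrightarrow> k < a \<Longrightarrow> l < a \<Longrightarrow> stack_mat d a P $$ (i*a+k, l) = P i $$ (k,l)"
  by (simp add: stack_mat_def pair_index_less)

lemma stack_mat_gram:
  assumes P: "\<And>i. i < d \<Longrightarrow> P i \<in> carrier_mat a a"
  shows "mat_adjoint (stack_mat d a P) * stack_mat d a P = mat_sum a a {..<d} (\<lambda>i. mat_adjoint (P i) * P i)"
proof (rule eq_matI)
  fix x y assume "x < dim_row (mat_sum a a {..<d} (\<lambda>i. mat_adjoint (P i) * P i))"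
    "y < dim_col (mat_sum a a {..<d} (\<lambda>i. mat_adjoint (P i) * P i))"
  then have xy: "x < a" "y < a" by auto
  have "(mat_adjoint (stack_mat d a P) * stack_mat d a P) $$ (x,y)
    = (\<Sum>k<d*a. mat_adjoint (stack_mat d a P) $$ (x,k) * stack_mat d a P $$ (k,y))"
    by (rule mult_mat_index[OF mat_adjoint_carrier[OF stack_mat_carrier] stack_mat_carrier xy])
  also have "\<dots> = (\<Sum>i<d. \<Sum>k<a. cnj (P i $$ (k,x)) * P i $$ (k,y))"
    unfolding sum_lessThan_mult using xy carrier_matD[OF stack_mat_carrier[of d a P]]
    by (intro sum.cong refl) (simp add: pair_index_less)
  also have "\<dots> = (\<Sum>i<d. (mat_adjoint (P i) * P i) $$ (x,y))"
  proof (intro sum.cong refl)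
    fix i assume "i \<in> {..<d}"
    then have "P i \<in> carrier_mat a a" using P by simp
    then show "(\<Sum>k<a. cnj (P i $$ (k,x)) * P i $$ (k,y)) = (mat_adjoint (P i) * P i) $$ (x,y)"
      using xy by (subst mult_mat_index[OF mat_adjoint_carrier[of _ a a]]) auto
  qed
  finally show "(mat_adjoint (stack_mat d a P) * stack_mat d a P) $$ (x,y)
    = mat_sum a a {..<d} (\<lambda>i. mat_adjoint (P i) * P i) $$ (x,y)" using xy by simp
qed (simp_all add: carrier_matD[OF stack_mat_carrier])

text \<open>Put S for the sum of the P_i adjoint times P_i. The corresponding sum for the matrix
  units is the identity, so (S \<otimes> 1)W = W and (S \<otimes> 1)\<xi> = \<xi>. Full rank of
  \<open>xi\<close> upgrades this to S = 1, which is the isometry condition for the stacked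
  matrix.\<close>

lemma stack_isometry_left:
  assumes W: "W \<in> carrier_mat (a*b) (p*r)" and psi: "psi \<in> carrier_vec (p*r)" "W *\<^sub>v psi = xi"
    and xi: "xi \<in> carrier_vec (a*b)" "invertible_mat (ptrace_2 a b (outer xi))" and p: "0 < p"
    and P: "\<And>i. i < p \<Longrightarrow> P i \<in> carrier_mat a a"
    and PW: "\<And>i. i < p \<Longrightarrow> kron_mat (P i) (1\<^sub>m b) * W = W * kron_mat (mat_unit p 0 i) (1\<^sub>m r)"
    and PW': "\<And>i. i < p \<Longrightarrow> kron_mat (mat_adjoint (P i)) (1\<^sub>m b) * W = W * kron_mat (mat_adjoint (mat_unit p 0 i)) (1\<^sub>m r)"
  shows "isometry_mat (p*a) a (stack_mat p a P)"
proof -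
  define S where "S = mat_sum a a {..<p} (\<lambda>i. mat_adjoint (P i) * P i)"
  have S: "S \<in> carrier_mat a a" by (simp add: S_def)
  have Q: "mat_adjoint (P i) * P i \<in> carrier_mat a a" if "i < p" for i
    by (rule mult_carrier_mat[OF mat_adjoint_carrier[OF P[OF that]] P[OF that]])
  have U: "mat_adjoint (mat_unit p 0 i) * mat_unit p 0 i \<in> carrier_mat p p" for i
    by (rule mult_carrier_mat[OF mat_adjoint_carrier[OF mat_unit_carrier] mat_unit_carrier])
  have "kron_mat (mat_adjoint (P i) * P i) (1\<^sub>m b) * W = W * kron_mat (mat_adjoint (mat_unit p 0 i) * mat_unit p 0 i) (1\<^sub>m r)"
    if i: "i < p" for i
  proof -
    have 1: "kron_mat (mat_adjoint (P i) * P i) (1\<^sub>m b) = kron_mat (mat_adjoint (P i)) (1\<^sub>m b) * kron_mat (P i) (1\<^sub>m b)"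
      using kron_mat_mult[OF mat_adjoint_carrier[OF P[OF i]] one_carrier_mat P[OF i] one_carrier_mat] by simp
    have 2: "kron_mat (mat_adjoint (mat_unit p 0 i) * mat_unit p 0 i) (1\<^sub>m r)
      = kron_mat (mat_adjoint (mat_unit p 0 i)) (1\<^sub>m r) * kron_mat (mat_unit p 0 i) (1\<^sub>m r)"
      using kron_mat_mult[OF mat_adjoint_carrier[OF mat_unit_carrier] one_carrier_mat mat_unit_carrier one_carrier_mat] by simp
    show ?thesis unfolding 1 2
      using P[OF i] by (intro intertwine_mult[OF W _ _ _ _ PW'[OF i] PW[OF i]]) auto
  qed
  then have "kron_mat (mat_sum a a {..<p} (\<lambda>i. 1 \<cdot>\<^sub>m (mat_adjoint (P i) * P i))) (1\<^sub>m b) * W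
    = W * kron_mat (mat_sum p p {..<p} (\<lambda>i. 1 \<cdot>\<^sub>m (mat_adjoint (mat_unit p 0 i) * mat_unit p 0 i))) (1\<^sub>m r)"
    using Q U by (intro intertwine_sum_left[OF W]) auto
  moreover have one: "1 \<cdot>\<^sub>m M = M" for M :: "complex mat" by (rule eq_matI) auto
  ultimately have SW: "kron_mat S (1\<^sub>m b) * W = W"
    using W unfolding one S_def[symmetric] mat_sum_adjoint_mat_unit[OF p] by simp
  have "kron_mat S (1\<^sub>m b) *\<^sub>v xi = xi"
    using assoc_mult_mat_vec[OF kron_mat_carrier[OF S one_carrier_mat] W psi(1)] unfolding SW psi(2) by simp
  then have "kron_mat (S - 1\<^sub>m a) (1\<^sub>m b) *\<^sub>v xi = 0\<^sub>v (a*b)"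
    unfolding kron_mat_minus_left[OF S one_carrier_mat one_carrier_mat]
    using minus_mult_distrib_mat_vec[OF kron_mat_carrier[OF S one_carrier_mat] kron_mat_carrier[OF one_carrier_mat one_carrier_mat] xi(1)] xi(1)
    by simp
  from full_rank_left[OF xi _ this] have "S - 1\<^sub>m a = 0\<^sub>m a a" by (simp add: minus_carrier_mat)
  then have "(S - 1\<^sub>m a) $$ (i,j) = 0" if "i < a" "j < a" for i j using that by simp
  then have "S = 1\<^sub>m a" using S by (intro eq_matI) auto
  then show ?thesis
    unfolding isometry_mat_def using stack_mat_gram[of p P a] P by (simp add: S_def)
qed

lemma stack_isometry_right:
  assumes W: "W \<in> carrier_mat (a*b) (p*r)" and psi: "psi \<in> carrier_vec (p*r)" "W *\<^sub>v psi = xi"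
    and xi: "xi \<in> carrier_vec (a*b)" "invertible_mat (ptrace_1 a b (outer xi))" and r: "0 < r"
    and P: "\<And>i. i < r \<Longrightarrow> P i \<in> carrier_mat b b"
    and PW: "\<And>i. i < r \<Longrightarrow> kron_mat (1\<^sub>m a) (P i) * W = W * kron_mat (1\<^sub>m p) (mat_unit r 0 i)"
    and PW': "\<And>i. i < r \<Longrightarrow> kron_mat (1\<^sub>m a) (mat_adjoint (P i)) * W = W * kron_mat (1\<^sub>m p) (mat_adjoint (mat_unit r 0 i))"
  shows "isometry_mat (r*b) b (stack_mat r b P)"
proof -
  define S where "S = mat_sum b b {..<r} (\<lambda>i. mat_adjoint (P i) * P i)"
  have S: "S \<in> carrier_mat b b" by (simp add: S_def)
  have Q: "mat_adjoint (P i) * P i \<in> carrier_mat b b" if "i < r" for i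
    by (rule mult_carrier_mat[OF mat_adjoint_carrier[OF P[OF that]] P[OF that]])
  have U: "mat_adjoint (mat_unit r 0 i) * mat_unit r 0 i \<in> carrier_mat r r" for i
    by (rule mult_carrier_mat[OF mat_adjoint_carrier[OF mat_unit_carrier] mat_unit_carrier])
  have "kron_mat (1\<^sub>m a) (mat_adjoint (P i) * P i) * W = W * kron_mat (1\<^sub>m p) (mat_adjoint (mat_unit r 0 i) * mat_unit r 0 i)"
    if i: "i < r" for i
  proof -
    have 1: "kron_mat (1\<^sub>m a) (mat_adjoint (P i) * P i) = kron_mat (1\<^sub>m a) (mat_adjoint (P i)) * kron_mat (1\<^sub>m a) (P i)"
      using kron_mat_mult[OF one_carrier_mat mat_adjoint_carrier[OF P[OF i]] one_carrier_mat P[OF i]] by simp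
    have 2: "kron_mat (1\<^sub>m p) (mat_adjoint (mat_unit r 0 i) * mat_unit r 0 i)
      = kron_mat (1\<^sub>m p) (mat_adjoint (mat_unit r 0 i)) * kron_mat (1\<^sub>m p) (mat_unit r 0 i)"
      using kron_mat_mult[OF one_carrier_mat mat_adjoint_carrier[OF mat_unit_carrier] one_carrier_mat mat_unit_carrier] by simp
    show ?thesis unfolding 1 2
      using P[OF i] by (intro intertwine_mult[OF W _ _ _ _ PW'[OF i] PW[OF i]]) auto
  qed
  then have "kron_mat (1\<^sub>m a) (mat_sum b b {..<r} (\<lambda>i. 1 \<cdot>\<^sub>m (mat_adjoint (P i) * P i))) * W
    = W * kron_mat (1\<^sub>m p) (mat_sum r r {..<r} (\<lambda>i. 1 \<cdot>\<^sub>m (mat_adjoint (mat_unit r 0 i) * mat_unit r 0 i)))"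
    using Q U by (intro intertwine_sum_right[OF W]) auto
  moreover have one: "1 \<cdot>\<^sub>m M = M" for M :: "complex mat" by (rule eq_matI) auto
  ultimately have SW: "kron_mat (1\<^sub>m a) S * W = W"
    using W unfolding one S_def[symmetric] mat_sum_adjoint_mat_unit[OF r] by simp
  have "kron_mat (1\<^sub>m a) S *\<^sub>v xi = xi"
    using assoc_mult_mat_vec[OF kron_mat_carrier[OF one_carrier_mat S] W psi(1)] unfolding SW psi(2) by simp
  then have "kron_mat (1\<^sub>m a) (S - 1\<^sub>m b) *\<^sub>v xi = 0\<^sub>v (a*b)"
    unfolding kron_mat_minus_right[OF S one_carrier_mat one_carrier_mat]
    using minus_mult_distrib_mat_vec[OF kron_mat_carrier[OF one_carrier_mat S] kron_mat_carrier[OF one_carrier_mat one_carrier_mat] xi(1)] xi(1)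
    by simp
  from full_rank_right[OF xi _ this] have "S - 1\<^sub>m b = 0\<^sub>m b b" by (simp add: minus_carrier_mat)
  then have "(S - 1\<^sub>m b) $$ (i,j) = 0" if "i < b" "j < b" for i j using that by simp
  then have "S = 1\<^sub>m b" using S by (intro eq_matI) auto
  then show ?thesis
    unfolding isometry_mat_def using stack_mat_gram[of r P b] P by (simp add: S_def)
qed

text \<open>Only the coordinate (i,j) of \<open>eta\<close> survives, and it lands on e_0 \<otimes>
  e_0, which under the pair indexing is the basis vector with index 0.\<close>

lemma kron_mat_unit_mult_vec:
  assumes "eta \<in> carrier_vec (p*r)" "i < p" "j < r"
  shows "kron_mat (mat_unit p 0 i) (mat_unit r 0 j) *\<^sub>v eta = eta $ (i*r+j) \<cdot>\<^sub>v unit_vec (p*r) 0"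
proof (rule eq_vec_pairI[of _ p r])
  fix k l assume kl: "k < p" "l < r"
  have "(kron_mat (mat_unit p 0 i) (mat_unit r 0 j) *\<^sub>v eta) $ (k*r+l)
    = (\<Sum>x<p. \<Sum>y<r. mat_unit p 0 i $$ (k,x) * mat_unit r 0 j $$ (l,y) * eta $ (x*r+y))"
    by (rule kron_mat_mult_vec_index[OF mat_unit_carrier mat_unit_carrier assms(1) kl])
  also have "\<dots> = (\<Sum>x<p. \<Sum>y<r. if y = j then if x = i then if k = 0 \<and> l = 0 then eta $ (i*r+j) else 0 else 0 else 0)"
    using kl by (intro sum.cong refl) simp
  also have "\<dots> = (if k = 0 \<and> l = 0 then eta $ (i*r+j) else 0)" using assms by simp
  finally show "(kron_mat (mat_unit p 0 i) (mat_unit r 0 j) *\<^sub>v eta) $ (k*r+l)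
      = (eta $ (i*r+j) \<cdot>\<^sub>v unit_vec (p*r) 0) $ (k*r+l)"
    using kl pair_index_less[OF kl] pair_index_less[of 0 p 0 r] by auto
next
  show "kron_mat (mat_unit p 0 i) (mat_unit r 0 j) *\<^sub>v eta \<in> carrier_vec (p*r)"
    by (rule mult_mat_vec_carrier[OF kron_mat_carrier[OF mat_unit_carrier mat_unit_carrier] assms(1)])
qed simp

text \<open>The block (i,j) of the left side is (P_i \<otimes> Q_j)W\<eta> = W(e_0i \<otimes>
  e_0j)\<eta>, the coordinate \<eta>_ij times the fixed vector W(e_0 \<otimes> e_0). So
  \<open>eta\<close> is split off exactly, and the auxiliary vector is the same for all
  \<open>eta\<close>.\<close>

lemma kron_stack_mult_vec:
  assumes W: "W \<in> carrier_mat (a*b) (p*r)" and eta: "eta \<in> carrier_vec (p*r)"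
    and P: "\<And>i. i < p \<Longrightarrow> P i \<in> carrier_mat a a" and Q: "\<And>j. j < r \<Longrightarrow> Q j \<in> carrier_mat b b"
    and PQ: "\<And>i j. i < p \<Longrightarrow> j < r \<Longrightarrow>
      kron_mat (P i) (Q j) * W = W * kron_mat (mat_unit p 0 i) (mat_unit r 0 j)"
  shows "kron_mat (stack_mat p a P) (stack_mat r b Q) *\<^sub>v (W *\<^sub>v eta)
    = reshuffle p r a b (kron_vec eta (W *\<^sub>v unit_vec (p*r) 0))"
proof (rule eq_vec_pairI[of _ "p*a" "r*b"])
  fix x y assume x: "x < p*a" and y: "y < r*b"
  obtain i k where ik: "i < p" "k < a" "x = i*a+k" using x by (rule pair_index_cases)
  obtain j l where jl: "j < r" "l < b" "y = j*b+l" using y by (rule pair_index_cases)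
  define zeta where "zeta = W *\<^sub>v unit_vec (p*r) 0"
  have zeta: "zeta \<in> carrier_vec (a*b)" unfolding zeta_def using W by simp
  have We: "W *\<^sub>v eta \<in> carrier_vec (a*b)" using W eta by simp
  have "(kron_mat (stack_mat p a P) (stack_mat r b Q) *\<^sub>v (W *\<^sub>v eta)) $ (x*(r*b)+y)
    = (\<Sum>m<a. \<Sum>n<b. stack_mat p a P $$ (x,m) * stack_mat r b Q $$ (y,n) * (W *\<^sub>v eta) $ (m*b+n))"
    by (rule kron_mat_mult_vec_index[OF stack_mat_carrier stack_mat_carrier We x y])
  also have "\<dots> = (\<Sum>m<a. \<Sum>n<b. P i $$ (k,m) * Q j $$ (l,n) * (W *\<^sub>v eta) $ (m*b+n))"
    using ik jl by (intro sum.cong refl) simp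
  also have "\<dots> = (kron_mat (P i) (Q j) *\<^sub>v (W *\<^sub>v eta)) $ (k*b+l)"
    by (rule kron_mat_mult_vec_index[OF P[OF ik(1)] Q[OF jl(1)] We ik(2) jl(2), symmetric])
  also have "kron_mat (P i) (Q j) *\<^sub>v (W *\<^sub>v eta) = W *\<^sub>v (kron_mat (mat_unit p 0 i) (mat_unit r 0 j) *\<^sub>v eta)"
    using assoc_mult_mat_vec[OF kron_mat_carrier[OF P[OF ik(1)] Q[OF jl(1)]] W eta]
      assoc_mult_mat_vec[OF W kron_mat_carrier[OF mat_unit_carrier mat_unit_carrier] eta] PQ[OF ik(1) jl(1)]
    by simp
  also have "\<dots> = eta $ (i*r+j) \<cdot>\<^sub>v zeta"
    unfolding kron_mat_unit_mult_vec[OF eta ik(1) jl(1)] zeta_def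
    by (rule mult_mat_vec[OF W unit_vec_carrier])
  also have "\<dots> $ (k*b+l) = eta $ (i*r+j) * zeta $ (k*b+l)"
    using zeta pair_index_less[OF ik(2) jl(2)] by simp
  also have "\<dots> = kron_vec eta zeta $ ((i*r+j)*(a*b) + (k*b+l))"
    using eta zeta pair_index_less[OF pair_index_less[OF ik(1) jl(1)] pair_index_less[OF ik(2) jl(2)]]
      pair_index_less[OF ik(2) jl(2)]
    by (simp add: kron_vec_def)
  \<comment> \<open>With x = i*a+k and y = j*b+l, \<open>reshuffle\<close> reads its argument at the
    place where (i,j) indexes \<open>eta\<close> and (k,l) indexes \<open>zeta\<close>.\<close>
  also have "\<dots> = reshuffle p r a b (kron_vec eta zeta) $ (x*(r*b)+y)"
    using pair_index_less[OF x y] y ik jl by (simp add: reshuffle_def Let_def)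
  finally show "(kron_mat (stack_mat p a P) (stack_mat r b Q) *\<^sub>v (W *\<^sub>v eta)) $ (x*(r*b)+y)
    = reshuffle p r a b (kron_vec eta (W *\<^sub>v unit_vec (p*r) 0)) $ (x*(r*b)+y)" by (simp only: zeta_def)
next
  show "kron_mat (stack_mat p a P) (stack_mat r b Q) *\<^sub>v (W *\<^sub>v eta) \<in> carrier_vec (p*a*(r*b))"
    by (rule mult_mat_vec_carrier[OF kron_mat_carrier[OF stack_mat_carrier stack_mat_carrier]])
      (use W eta in simp)
qed (simp add: reshuffle_def)

lemma mat_adjoint_lincomb:
  assumes "\<And>k. k \<in> I \<Longrightarrow> K k \<in> carrier_mat m n"
  shows "mat_adjoint (mat_sum m n I (\<lambda>k. c k \<cdot>\<^sub>m K k)) = mat_sum n m I (\<lambda>k. cnj (c k) \<cdot>\<^sub>m mat_adjoint (K k))"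
proof -
  have "c k \<cdot>\<^sub>m K k \<in> carrier_mat m n" if "k \<in> I" for k using assms[OF that] by simp
  from mat_adjoint_mat_sum[OF this] show ?thesis by (simp add: mat_adjoint_smult)
qed

lemma unitary_in_kron:
  assumes "unitary_in m X" "unitary_in n Y"
  shows "unitary_in (m*n) (kron_mat X Y)"
proof -
  have c: "X \<in> carrier_mat m m" "Y \<in> carrier_mat n n" "mat_adjoint X \<in> carrier_mat m m" "mat_adjoint Y \<in> carrier_mat n n"
    using assms by (auto simp: unitary_in_def)
  show ?thesis
    using assms kron_mat_mult[OF c(1,2) c(3,4)] kron_mat_mult[OF c(3,4) c(1,2)] c
    by (simp add: unitary_in_def mat_adjoint_kron)
qed

lemma unitary_in_one: "unitary_in n (1\<^sub>m n)"
  by (simp add: unitary_in_def)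

lemma kron_mult_vec_split:
  assumes "X \<in> carrier_mat m m" "Y \<in> carrier_mat n n" "v \<in> carrier_vec (m*n)"
  shows "kron_mat X (1\<^sub>m n) *\<^sub>v (kron_mat (1\<^sub>m m) Y *\<^sub>v v) = kron_mat X Y *\<^sub>v v"
    and "kron_mat (1\<^sub>m m) Y *\<^sub>v (kron_mat X (1\<^sub>m n) *\<^sub>v v) = kron_mat X Y *\<^sub>v v"
proof -
  have c: "kron_mat X (1\<^sub>m n) \<in> carrier_mat (m*n) (m*n)" "kron_mat (1\<^sub>m m) Y \<in> carrier_mat (m*n) (m*n)"
    using assms by auto
  show "kron_mat X (1\<^sub>m n) *\<^sub>v (kron_mat (1\<^sub>m m) Y *\<^sub>v v) = kron_mat X Y *\<^sub>v v"
    using assoc_mult_mat_vec[OF c(1,2) assms(3)] kron_mat_split[OF assms(1,2)] by simp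
  show "kron_mat (1\<^sub>m m) Y *\<^sub>v (kron_mat X (1\<^sub>m n) *\<^sub>v v) = kron_mat X Y *\<^sub>v v"
    using assoc_mult_mat_vec[OF c(2,1) assms(3)]
      kron_mat_mult[OF one_carrier_mat assms(2,1) one_carrier_mat] assms(1,2) by simp
qed

section \<open>Self-testing: the global isometry, its intertwining relations and the local
  isometries\<close>

theorem theoremp:
  fixes G :: "('g,'b) monoid_scheme" and dpi drho :: nat
    and repr rho :: "'g \<Rightarrow> complex mat" and psi :: "complex vec"
  assumes "group G" and "finite (carrier G)"
    and "unitary_rep G dpi repr" and "irreducible_rep G dpi repr"
    and "unitary_rep G drho rho" and "irreducible_rep G drho rho"
    and "unit_vec_in (dpi * drho) psi" and "marginally_cyclic dpi drho psi"
    and "mat_span (dpi * drho) (carrier G \<times> carrier G)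
           (\<lambda>(s,t). kron_mat (repr s) (rho t) * outer psi * mat_adjoint (kron_mat (repr s) (rho t)))
         = carrier_mat (dpi * drho) (dpi * drho)"
  shows "\<forall>(dA::nat) (dB::nat) (E :: 'g \<Rightarrow> 'g \<Rightarrow> 'g \<Rightarrow> 'g \<Rightarrow> complex mat)
            (F :: 'g \<Rightarrow> 'g \<Rightarrow> 'g \<Rightarrow> 'g \<Rightarrow> complex mat) (xi :: complex vec).
     full_rank_model G dA dB E F xi \<and>
     gchannel_eq G (qns_corr G E F xi)
       (schur_channel G (\<lambda>s t. (kron_mat (repr s) (rho t) *\<^sub>v psi) \<bullet>c psi))
     \<longrightarrow> (\<exists>(dAaux::nat) (dBaux::nat) TA TB xiaux.
           isometry_mat (dpi * dAaux) dA TA \<and> isometry_mat (drho * dBaux) dB TB \<and>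
           unit_vec_in (dAaux * dBaux) xiaux \<and>
           (\<forall>s\<in>carrier G. \<forall>s'\<in>carrier G. \<forall>g\<in>carrier G. \<forall>g'\<in>carrier G.
            \<forall>t\<in>carrier G. \<forall>t'\<in>carrier G. \<forall>h\<in>carrier G. \<forall>h'\<in>carrier G.
              kron_mat TA TB *\<^sub>v (kron_mat (E s s' g g') (F t t' h h') *\<^sub>v xi)
              = reshuffle dpi drho dAaux dBaux
                  (kron_vec (kron_mat (rep_usom G dpi repr s s' g g') (rep_usom G drho rho t t' h h') *\<^sub>v psi)
                            xiaux)))"
proof (intro allI impI, elim conjE)
  fix a b :: nat and E F :: "'g \<Rightarrow> 'g \<Rightarrow> 'g \<Rightarrow> 'g \<Rightarrow> complex mat" and xi :: "complex vec"
  let ?p = dpi and ?r = drho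
  let ?u = "\<lambda>s t. (kron_mat (repr s) (rho t) *\<^sub>v psi) \<bullet>c psi"
  assume model: "full_rank_model G a b E F xi"
    and corr: "gchannel_eq G (qns_corr G E F xi) (schur_channel G ?u)"
  interpret group G by fact
  have E: "usom G a E" and F: "usom G b F" and xi: "xi \<in> carrier_vec (a*b)"
    and invA: "invertible_mat (ptrace_2 a b (outer xi))" and invB: "invertible_mat (ptrace_1 a b (outer xi))"
    using model by (auto simp: full_rank_model_def unitary_model_def unit_vec_in_def)
  have psi: "psi \<in> carrier_vec (?p*?r)" using assms(7) by (simp add: unit_vec_in_def)
  have p0: "0 < ?p" and r0: "0 < ?r" using assms(4,6) by (auto simp: irreducible_rep_def)
  have pu: "unitary_in ?p (repr s)" "repr s \<in> carrier_mat ?p ?p" if "s \<in> carrier G" for s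
    using assms(3) that by (auto simp: unitary_rep_def unitary_in_def)
  have ru: "unitary_in ?r (rho s)" "rho s \<in> carrier_mat ?r ?r" if "s \<in> carrier G" for s
    using assms(5) that by (auto simp: unitary_rep_def unitary_in_def)
  note entry = correlation_entry[OF assms(2) corr]
  \<comment> \<open>In the diagonal entries the input of the second party is set to the group unit;
    for g \<noteq> s the correlation vanishes for every output \<open>h\<close>.\<close>
  have offE: "E s s g g = 0\<^sub>m a a" if "s \<in> carrier G" "g \<in> carrier G" "g \<noteq> s" for s g
    by (rule usom_off_diagonal_left[OF assms(1,2) E F xi invA _ that(1,2)]) (use that in \<open>simp add: entry\<close>)
  obtain A where A: "\<And>s. s \<in> carrier G \<Longrightarrow> unitary_in a (A s)" and A1: "A \<one>\<^bsub>G\<^esub> = 1\<^sub>m a"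
    and EA: "\<And>s s' g g'. s \<in> carrier G \<Longrightarrow> s' \<in> carrier G \<Longrightarrow> g \<in> carrier G \<Longrightarrow> g' \<in> carrier G \<Longrightarrow>
      E s s' g g' = (if g = s \<and> g' = s' then mat_adjoint (A s) * A s' else 0\<^sub>m a a)"
  proof -
    show thesis
    proof (rule usom_diagonal[OF assms(1,2) E])
      show "E s s g g = 0\<^sub>m a a" if "s \<in> carrier G" "g \<in> carrier G" "g \<noteq> s" for s g
        by (rule offE[OF that])
    qed (fact that)
  qed
  have offF: "F t t h h = 0\<^sub>m b b" if "t \<in> carrier G" "h \<in> carrier G" "h \<noteq> t" for t h
    by (rule usom_off_diagonal_right[OF assms(1,2) E F xi invB _ that(1,2)]) (use that in \<open>simp add: entry\<close>)
  obtain B where B: "\<And>s. s \<in> carrier G \<Longrightarrow> unitary_in b (B s)" and B1: "B \<one>\<^bsub>G\<^esub> = 1\<^sub>m b"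
    and FB: "\<And>s s' g g'. s \<in> carrier G \<Longrightarrow> s' \<in> carrier G \<Longrightarrow> g \<in> carrier G \<Longrightarrow> g' \<in> carrier G \<Longrightarrow>
      F s s' g g' = (if g = s \<and> g' = s' then mat_adjoint (B s) * B s' else 0\<^sub>m b b)"
  proof -
    show thesis
    proof (rule usom_diagonal[OF assms(1,2) F])
      show "F s s g g = 0\<^sub>m b b" if "s \<in> carrier G" "g \<in> carrier G" "g \<noteq> s" for s g
        by (rule offF[OF that])
    qed (fact that)
  qed
  have Ac: "A s \<in> carrier_mat a a" and Bc: "B s \<in> carrier_mat b b" if "s \<in> carrier G" for s
    using A[OF that] B[OF that] by (auto simp: unitary_in_def)

  \<comment> \<open>The second vector of the inner product contributes the adjoint, so the primed
    indices come first: the operators are the USOM entries with inputs and outputs (s',s) and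
    (t',t).\<close>
  have gram: "(kron_mat (A s) (B t) *\<^sub>v xi) \<bullet>c (kron_mat (A s') (B t') *\<^sub>v xi)
      = (kron_mat (repr s) (rho t) *\<^sub>v psi) \<bullet>c (kron_mat (repr s') (rho t') *\<^sub>v psi)"
    if m: "s \<in> carrier G" "t \<in> carrier G" "s' \<in> carrier G" "t' \<in> carrier G" for s t s' t'
  proof -
    have "(kron_mat (A s) (B t) *\<^sub>v xi) \<bullet>c (kron_mat (A s') (B t') *\<^sub>v xi)
      = (kron_mat (E s' s s' s) (F t' t t' t) *\<^sub>v xi) \<bullet>c xi"
      using kron_gram[OF Ac[OF m(1)] Ac[OF m(3)] Bc[OF m(2)] Bc[OF m(4)] xi] EA[OF m(3,1) m(3,1)] FB[OF m(4,2) m(4,2)]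
      by simp
    also have "\<dots> = ?u (inv\<^bsub>G\<^esub> s' \<otimes>\<^bsub>G\<^esub> s) (inv\<^bsub>G\<^esub> t' \<otimes>\<^bsub>G\<^esub> t)"
      using entry[OF m(3,1) m(3,1) m(4,2) m(4,2)] by simp
    also have "\<dots> = (kron_mat (repr s) (rho t) *\<^sub>v psi) \<bullet>c (kron_mat (repr s') (rho t') *\<^sub>v psi)"
      using kron_gram[OF pu(2)[OF m(1)] pu(2)[OF m(3)] ru(2)[OF m(2)] ru(2)[OF m(4)] psi]
        unitary_rep_inv_mult[OF assms(1,3) m(3,1)] unitary_rep_inv_mult[OF assms(1,5) m(4,2)]
      by simp
    finally show ?thesis .
  qed
  \<comment> \<open>The frame constant of the orbit of \<open>psi\<close>, one factor from each
    representation. It is real, and nonzero because a finite group has positive order.\<close>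
  let ?C = "of_nat (card (carrier G)) / of_nat ?p * (of_nat (card (carrier G)) / of_nat ?r) :: complex"
  have C: "?C \<noteq> 0" "cnj ?C = ?C"
    using p0 r0 assms(2) by (auto simp: card_eq_0_iff)
  obtain W where W: "W \<in> carrier_mat (a*b) (?p*?r)" and W1: "mat_adjoint W * W = 1\<^sub>m (?p*?r)"
    and WG: "\<And>k. k \<in> carrier G \<times> carrier G \<Longrightarrow>
      W *\<^sub>v (case k of (s,t) \<Rightarrow> kron_mat (repr s) (rho t) *\<^sub>v psi) = (case k of (s,t) \<Rightarrow> kron_mat (A s) (B t) *\<^sub>v xi)"
  proof -
    show thesis
    proof (rule frame_isometry[where I = "carrier G \<times> carrier G" and m = "a*b" and n = "?p*?r"
          and x = "\<lambda>(s,t). kron_mat (A s) (B t) *\<^sub>v xi" and y = "\<lambda>(s,t). kron_mat (repr s) (rho t) *\<^sub>v psi"])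
      fix k assume "k \<in> carrier G \<times> carrier G"
      then obtain s t where k: "k = (s,t)" "s \<in> carrier G" "t \<in> carrier G" by blast
      show "(case k of (s,t) \<Rightarrow> kron_mat (A s) (B t) *\<^sub>v xi) \<in> carrier_vec (a*b)"
        using mult_mat_vec_carrier[OF kron_mat_carrier[OF Ac[OF k(2)] Bc[OF k(3)]] xi] k(1) by simp
      show "(case k of (s,t) \<Rightarrow> kron_mat (repr s) (rho t) *\<^sub>v psi) \<in> carrier_vec (?p*?r)"
        using mult_mat_vec_carrier[OF kron_mat_carrier[OF pu(2)[OF k(2)] ru(2)[OF k(3)]] psi] k(1) by simp
    next
      fix k l assume "k \<in> carrier G \<times> carrier G" "l \<in> carrier G \<times> carrier G"
      then show "(case k of (s,t) \<Rightarrow> kron_mat (A s) (B t) *\<^sub>v xi) \<bullet>c (case l of (s,t) \<Rightarrow> kron_mat (A s) (B t) *\<^sub>v xi)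
        = (case k of (s,t) \<Rightarrow> kron_mat (repr s) (rho t) *\<^sub>v psi) \<bullet>c (case l of (s,t) \<Rightarrow> kron_mat (repr s) (rho t) *\<^sub>v psi)"
        by (auto simp: gram)
    next
      fix i j assume "i < ?p*?r" "j < ?p*?r"
      from tensor_orbit_frame[OF assms(1,2,4,3,6,5,7) this]
      show "(\<Sum>k\<in>carrier G \<times> carrier G. (case k of (s,t) \<Rightarrow> kron_mat (repr s) (rho t) *\<^sub>v psi) $ i *
        cnj ((case k of (s,t) \<Rightarrow> kron_mat (repr s) (rho t) *\<^sub>v psi) $ j)) = (if i = j then ?C else 0)"
        by (simp only: case_prod_unfold)
    qed (fact C that)+
  qed
  have WG: "W *\<^sub>v (kron_mat (repr s) (rho t) *\<^sub>v psi) = kron_mat (A s) (B t) *\<^sub>v xi"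
    if "s \<in> carrier G" "t \<in> carrier G" for s t
    using WG[of "(s,t)"] that by simp
  note p1 = unitary_rep_one[OF assms(1,3)] and r1 = unitary_rep_one[OF assms(1,5)]
  have Wpsi: "W *\<^sub>v psi = xi"
    using WG[OF one_closed one_closed] psi xi by (simp add: p1 r1 A1 B1)

  \<comment> \<open>The test vectors are the orbit under the other factor: W sends (1 \<otimes>
    \<rho>(t))\<psi> to (1 \<otimes> B_t)\<xi>, since A is the identity at the group unit, and both
    sides then give (A_s \<otimes> B_t)\<xi>.\<close>
  have L: "kron_mat (A s) (1\<^sub>m b) * W = W * kron_mat (repr s) (1\<^sub>m ?r)" if s: "s \<in> carrier G" for s
  proof (rule mat_eq_on_right_orbit[OF assms(1,2,6,5,8)])
    have kA: "kron_mat (A s) (1\<^sub>m b) \<in> carrier_mat (a*b) (a*b)" using Ac[OF s] by simp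
    have kp: "kron_mat (repr s) (1\<^sub>m ?r) \<in> carrier_mat (?p*?r) (?p*?r)" using pu(2)[OF s] by simp
    show "kron_mat (A s) (1\<^sub>m b) * W \<in> carrier_mat (a*b) (?p*?r)" "W * kron_mat (repr s) (1\<^sub>m ?r) \<in> carrier_mat (a*b) (?p*?r)"
      using mult_carrier_mat[OF kA W] mult_carrier_mat[OF W kp] by auto
    fix t assume t: "t \<in> carrier G"
    have v: "kron_mat (1\<^sub>m ?p) (rho t) *\<^sub>v psi \<in> carrier_vec (?p*?r)"
      by (rule mult_mat_vec_carrier[OF kron_mat_carrier[OF one_carrier_mat ru(2)[OF t]] psi])
    have "(kron_mat (A s) (1\<^sub>m b) * W) *\<^sub>v (kron_mat (1\<^sub>m ?p) (rho t) *\<^sub>v psi)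
        = kron_mat (A s) (1\<^sub>m b) *\<^sub>v (kron_mat (1\<^sub>m a) (B t) *\<^sub>v xi)"
      using assoc_mult_mat_vec[OF kA W v] WG[OF one_closed t] by (simp add: p1 A1)
    also have "\<dots> = W *\<^sub>v (kron_mat (repr s) (rho t) *\<^sub>v psi)"
      unfolding kron_mult_vec_split(1)[OF Ac[OF s] Bc[OF t] xi] WG[OF s t] ..
    also have "\<dots> = (W * kron_mat (repr s) (1\<^sub>m ?r)) *\<^sub>v (kron_mat (1\<^sub>m ?p) (rho t) *\<^sub>v psi)"
      unfolding assoc_mult_mat_vec[OF W kp v] kron_mult_vec_split(1)[OF pu(2)[OF s] ru(2)[OF t] psi] ..
    finally show "(kron_mat (A s) (1\<^sub>m b) * W) *\<^sub>v (kron_mat (1\<^sub>m ?p) (rho t) *\<^sub>v psi)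
      = (W * kron_mat (repr s) (1\<^sub>m ?r)) *\<^sub>v (kron_mat (1\<^sub>m ?p) (rho t) *\<^sub>v psi)" .
  qed
  have R: "kron_mat (1\<^sub>m a) (B t) * W = W * kron_mat (1\<^sub>m ?p) (rho t)" if t: "t \<in> carrier G" for t
  proof (rule mat_eq_on_left_orbit[OF assms(1,2,4,3,8)])
    have kB: "kron_mat (1\<^sub>m a) (B t) \<in> carrier_mat (a*b) (a*b)" using Bc[OF t] by simp
    have kr: "kron_mat (1\<^sub>m ?p) (rho t) \<in> carrier_mat (?p*?r) (?p*?r)" using ru(2)[OF t] by simp
    show "kron_mat (1\<^sub>m a) (B t) * W \<in> carrier_mat (a*b) (?p*?r)" "W * kron_mat (1\<^sub>m ?p) (rho t) \<in> carrier_mat (a*b) (?p*?r)"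
      using mult_carrier_mat[OF kB W] mult_carrier_mat[OF W kr] by auto
    fix s assume s: "s \<in> carrier G"
    have v: "kron_mat (repr s) (1\<^sub>m ?r) *\<^sub>v psi \<in> carrier_vec (?p*?r)"
      by (rule mult_mat_vec_carrier[OF kron_mat_carrier[OF pu(2)[OF s] one_carrier_mat] psi])
    have "(kron_mat (1\<^sub>m a) (B t) * W) *\<^sub>v (kron_mat (repr s) (1\<^sub>m ?r) *\<^sub>v psi)
        = kron_mat (1\<^sub>m a) (B t) *\<^sub>v (kron_mat (A s) (1\<^sub>m b) *\<^sub>v xi)"
      using assoc_mult_mat_vec[OF kB W v] WG[OF s one_closed] by (simp add: r1 B1)
    also have "\<dots> = W *\<^sub>v (kron_mat (repr s) (rho t) *\<^sub>v psi)"
      unfolding kron_mult_vec_split(2)[OF Ac[OF s] Bc[OF t] xi] WG[OF s t] ..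
    also have "\<dots> = (W * kron_mat (1\<^sub>m ?p) (rho t)) *\<^sub>v (kron_mat (repr s) (1\<^sub>m ?r) *\<^sub>v psi)"
      unfolding assoc_mult_mat_vec[OF W kr v] kron_mult_vec_split(2)[OF pu(2)[OF s] ru(2)[OF t] psi] ..
    finally show "(kron_mat (1\<^sub>m a) (B t) * W) *\<^sub>v (kron_mat (repr s) (1\<^sub>m ?r) *\<^sub>v psi)
      = (W * kron_mat (1\<^sub>m ?p) (rho t)) *\<^sub>v (kron_mat (repr s) (1\<^sub>m ?r) *\<^sub>v psi)" .
  qed
  \<comment> \<open>Adjoints need their own relation: A_s is not known to be multiplicative in s, so
    its adjoint cannot be replaced by the operator at the inverse group element.\<close>
  have L': "kron_mat (mat_adjoint (A s)) (1\<^sub>m b) * W = W * kron_mat (mat_adjoint (repr s)) (1\<^sub>m ?r)" if s: "s \<in> carrier G" for s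
    using intertwine_adjoint[OF W unitary_in_kron[OF A[OF s] unitary_in_one] unitary_in_kron[OF pu(1)[OF s] unitary_in_one] L[OF s]]
    by (simp add: mat_adjoint_kron)
  have R': "kron_mat (1\<^sub>m a) (mat_adjoint (B t)) * W = W * kron_mat (1\<^sub>m ?p) (mat_adjoint (rho t))" if t: "t \<in> carrier G" for t
    using intertwine_adjoint[OF W unitary_in_kron[OF unitary_in_one B[OF t]] unitary_in_kron[OF unitary_in_one ru(1)[OF t]] R[OF t]]
    by (simp add: mat_adjoint_kron)

  \<comment> \<open>Both USOMs are supported on g = s, g' = s'. There the relations
    \<open>L'\<close> and \<open>L\<close> multiply; elsewhere both sides are zero.\<close>
  have EW: "kron_mat (E s s' g g') (1\<^sub>m b) * W = W * kron_mat (rep_usom G ?p repr s s' g g') (1\<^sub>m ?r)"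
    and Ec: "E s s' g g' \<in> carrier_mat a a" and rEc: "rep_usom G ?p repr s s' g g' \<in> carrier_mat ?p ?p"
    if m: "s \<in> carrier G" "s' \<in> carrier G" "g \<in> carrier G" "g' \<in> carrier G" for s s' g g'
  proof -
    have k: "kron_mat (mat_adjoint (A s) * A s') (1\<^sub>m b) = kron_mat (mat_adjoint (A s)) (1\<^sub>m b) * kron_mat (A s') (1\<^sub>m b)"
      using kron_mat_mult[OF mat_adjoint_carrier[OF Ac[OF m(1)]] one_carrier_mat Ac[OF m(2)] one_carrier_mat] by simp
    have k': "kron_mat (mat_adjoint (repr s) * repr s') (1\<^sub>m ?r) = kron_mat (mat_adjoint (repr s)) (1\<^sub>m ?r) * kron_mat (repr s') (1\<^sub>m ?r)"
      using kron_mat_mult[OF mat_adjoint_carrier[OF pu(2)[OF m(1)]] one_carrier_mat pu(2)[OF m(2)] one_carrier_mat] by simp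
    have "kron_mat (mat_adjoint (A s) * A s') (1\<^sub>m b) * W = W * kron_mat (mat_adjoint (repr s) * repr s') (1\<^sub>m ?r)"
      unfolding k k' using Ac[OF m(1)] Ac[OF m(2)] pu(2)[OF m(1)] pu(2)[OF m(2)]
      by (intro intertwine_mult[OF W _ _ _ _ L'[OF m(1)] L[OF m(2)]]) auto
    then show "kron_mat (E s s' g g') (1\<^sub>m b) * W = W * kron_mat (rep_usom G ?p repr s s' g g') (1\<^sub>m ?r)"
      using W unfolding EA[OF m] rep_usom_def unitary_rep_inv_mult[OF assms(1,3) m(1,2)] by auto
    show "E s s' g g' \<in> carrier_mat a a" "rep_usom G ?p repr s s' g g' \<in> carrier_mat ?p ?p"
      unfolding EA[OF m] rep_usom_def unitary_rep_inv_mult[OF assms(1,3) m(1,2)]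
      using mult_carrier_mat[OF mat_adjoint_carrier[OF Ac[OF m(1)]] Ac[OF m(2)]]
        mult_carrier_mat[OF mat_adjoint_carrier[OF pu(2)[OF m(1)]] pu(2)[OF m(2)]] by simp_all
  qed
  have FW: "kron_mat (1\<^sub>m a) (F s s' g g') * W = W * kron_mat (1\<^sub>m ?p) (rep_usom G ?r rho s s' g g')"
    and Fc: "F s s' g g' \<in> carrier_mat b b" and rFc: "rep_usom G ?r rho s s' g g' \<in> carrier_mat ?r ?r"
    if m: "s \<in> carrier G" "s' \<in> carrier G" "g \<in> carrier G" "g' \<in> carrier G" for s s' g g'
  proof -
    have k: "kron_mat (1\<^sub>m a) (mat_adjoint (B s) * B s') = kron_mat (1\<^sub>m a) (mat_adjoint (B s)) * kron_mat (1\<^sub>m a) (B s')"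
      using kron_mat_mult[OF one_carrier_mat mat_adjoint_carrier[OF Bc[OF m(1)]] one_carrier_mat Bc[OF m(2)]] by simp
    have k': "kron_mat (1\<^sub>m ?p) (mat_adjoint (rho s) * rho s') = kron_mat (1\<^sub>m ?p) (mat_adjoint (rho s)) * kron_mat (1\<^sub>m ?p) (rho s')"
      using kron_mat_mult[OF one_carrier_mat mat_adjoint_carrier[OF ru(2)[OF m(1)]] one_carrier_mat ru(2)[OF m(2)]] by simp
    have "kron_mat (1\<^sub>m a) (mat_adjoint (B s) * B s') * W = W * kron_mat (1\<^sub>m ?p) (mat_adjoint (rho s) * rho s')"
      unfolding k k' using Bc[OF m(1)] Bc[OF m(2)] ru(2)[OF m(1)] ru(2)[OF m(2)]
      by (intro intertwine_mult[OF W _ _ _ _ R'[OF m(1)] R[OF m(2)]]) auto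
    then show "kron_mat (1\<^sub>m a) (F s s' g g') * W = W * kron_mat (1\<^sub>m ?p) (rep_usom G ?r rho s s' g g')"
      using W unfolding FB[OF m] rep_usom_def unitary_rep_inv_mult[OF assms(1,5) m(1,2)] by auto
    show "F s s' g g' \<in> carrier_mat b b" "rep_usom G ?r rho s s' g g' \<in> carrier_mat ?r ?r"
      unfolding FB[OF m] rep_usom_def unitary_rep_inv_mult[OF assms(1,5) m(1,2)]
      using mult_carrier_mat[OF mat_adjoint_carrier[OF Bc[OF m(1)]] Bc[OF m(2)]]
        mult_carrier_mat[OF mat_adjoint_carrier[OF ru(2)[OF m(1)]] ru(2)[OF m(2)]] by simp_all
  qed

  \<comment> \<open>The coefficients that write e_0i as a combination of the representation
    matrices. Used with the unitaries \<open>A s\<close> they give \<open>P i\<close>, the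
    counterpart of e_0i on the first space of the model.\<close>
  define c where "c i s = of_nat ?p / of_nat (card (carrier G)) * cnj (repr s $$ (0,i))" for i s
  define P where "P i = mat_sum a a (carrier G) (\<lambda>s. c i s \<cdot>\<^sub>m A s)" for i
  have cU: "mat_sum ?p ?p (carrier G) (\<lambda>s. c i s \<cdot>\<^sub>m repr s) = mat_unit ?p 0 i" if "i < ?p" for i
    unfolding c_def by (rule mat_unit_eq_rep_sum[OF assms(1,2,4,3) p0 that])
  have PW: "kron_mat (P i) (1\<^sub>m b) * W = W * kron_mat (mat_unit ?p 0 i) (1\<^sub>m ?r)" if "i < ?p" for i
    unfolding P_def cU[OF that, symmetric] by (rule intertwine_sum_left[OF W Ac pu(2) L])
  \<comment> \<open>The adjoint of e_0i is expanded with conjugated coefficients in the adjoints of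
    the representation matrices, so that it matches the adjoint of \<open>P i\<close> term by
    term.\<close>
  have PW': "kron_mat (mat_adjoint (P i)) (1\<^sub>m b) * W = W * kron_mat (mat_adjoint (mat_unit ?p 0 i)) (1\<^sub>m ?r)" if "i < ?p" for i
  proof -
    have 1: "mat_adjoint (P i) = mat_sum a a (carrier G) (\<lambda>s. cnj (c i s) \<cdot>\<^sub>m mat_adjoint (A s))"
      unfolding P_def by (rule mat_adjoint_lincomb[OF Ac])
    have 2: "mat_adjoint (mat_unit ?p 0 i) = mat_sum ?p ?p (carrier G) (\<lambda>s. cnj (c i s) \<cdot>\<^sub>m mat_adjoint (repr s))"
      unfolding cU[OF that, symmetric] by (rule mat_adjoint_lincomb[OF pu(2)])
    show ?thesis unfolding 1 2
      by (rule intertwine_sum_left[OF W mat_adjoint_carrier[OF Ac] mat_adjoint_carrier[OF pu(2)] L'])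
  qed
  have Pc: "P i \<in> carrier_mat a a" for i by (simp add: P_def)

  define d where "d i s = of_nat ?r / of_nat (card (carrier G)) * cnj (rho s $$ (0,i))" for i s
  define Q where "Q i = mat_sum b b (carrier G) (\<lambda>s. d i s \<cdot>\<^sub>m B s)" for i
  have dU: "mat_sum ?r ?r (carrier G) (\<lambda>s. d i s \<cdot>\<^sub>m rho s) = mat_unit ?r 0 i" if "i < ?r" for i
    unfolding d_def by (rule mat_unit_eq_rep_sum[OF assms(1,2,6,5) r0 that])
  have QW: "kron_mat (1\<^sub>m a) (Q i) * W = W * kron_mat (1\<^sub>m ?p) (mat_unit ?r 0 i)" if "i < ?r" for i
    unfolding Q_def dU[OF that, symmetric] by (rule intertwine_sum_right[OF W Bc ru(2) R])
  have QW': "kron_mat (1\<^sub>m a) (mat_adjoint (Q i)) * W = W * kron_mat (1\<^sub>m ?p) (mat_adjoint (mat_unit ?r 0 i))" if "i < ?r" for i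
  proof -
    have 1: "mat_adjoint (Q i) = mat_sum b b (carrier G) (\<lambda>s. cnj (d i s) \<cdot>\<^sub>m mat_adjoint (B s))"
      unfolding Q_def by (rule mat_adjoint_lincomb[OF Bc])
    have 2: "mat_adjoint (mat_unit ?r 0 i) = mat_sum ?r ?r (carrier G) (\<lambda>s. cnj (d i s) \<cdot>\<^sub>m mat_adjoint (rho s))"
      unfolding dU[OF that, symmetric] by (rule mat_adjoint_lincomb[OF ru(2)])
    show ?thesis unfolding 1 2
      by (rule intertwine_sum_right[OF W mat_adjoint_carrier[OF Bc] mat_adjoint_carrier[OF ru(2)] R'])
  qed
  have Qc: "Q i \<in> carrier_mat b b" for i by (simp add: Q_def)

  \<comment> \<open>The auxiliary spaces are the spaces of the model itself, of dimensions
    \<open>a\<close> and \<open>b\<close>, and the auxiliary vector is \<open>W\<close> applied to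
    e_0 \<otimes> e_0, a unit vector because \<open>W\<close> is an isometry.\<close>
  let ?TA = "stack_mat ?p a P" and ?TB = "stack_mat ?r b Q" and ?e = "unit_vec (?p*?r) 0 :: complex vec"
  have "isometry_mat (?p*a) a ?TA"
    by (rule stack_isometry_left[OF W psi Wpsi xi invA p0 Pc PW PW'])
  moreover have "isometry_mat (?r*b) b ?TB"
    by (rule stack_isometry_right[OF W psi Wpsi xi invB r0 Qc QW QW'])
  moreover have "unit_vec_in (a*b) (W *\<^sub>v ?e)"
  proof -
    have e: "?e \<in> carrier_vec (?p*?r)" by simp
    have We: "W *\<^sub>v ?e \<in> carrier_vec (a*b)" by (rule mult_mat_vec_carrier[OF W e])
    have "(W *\<^sub>v ?e) \<bullet>c (W *\<^sub>v ?e) = ?e \<bullet>c ((mat_adjoint W * W) *\<^sub>v ?e)"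
      unfolding cscalar_mult_mat_vec[OF W e We] assoc_mult_mat_vec[OF mat_adjoint_carrier[OF W] W e] ..
    also have "\<dots> = ?e \<bullet>c ?e" unfolding W1 one_mult_mat_vec[OF e] ..
    also have "\<dots> = (\<Sum>i<?p*?r. if i = 0 then 1 else 0)"
      unfolding cscalar_eq_sum[OF e e] by (intro sum.cong refl) (auto simp: unit_vec_def)
    also have "\<dots> = 1" using p0 r0 by simp
    finally show ?thesis using We by (simp add: unit_vec_in_def)
  qed
  moreover have "kron_mat ?TA ?TB *\<^sub>v (kron_mat (E s s' g g') (F t t' h h') *\<^sub>v xi)
      = reshuffle ?p ?r a b (kron_vec (kron_mat (rep_usom G ?p repr s s' g g') (rep_usom G ?r rho t t' h h') *\<^sub>v psi) (W *\<^sub>v ?e))"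
    if m: "s \<in> carrier G" "s' \<in> carrier G" "g \<in> carrier G" "g' \<in> carrier G"
      and n: "t \<in> carrier G" "t' \<in> carrier G" "h \<in> carrier G" "h' \<in> carrier G" for s s' g g' t t' h h'
  proof -
    let ?K = "kron_mat (rep_usom G ?p repr s s' g g') (rep_usom G ?r rho t t' h h')"
    have Kc: "?K \<in> carrier_mat (?p*?r) (?p*?r)" by (rule kron_mat_carrier[OF rEc[OF m] rFc[OF n]])
    have EFW: "kron_mat (E s s' g g') (F t t' h h') * W = W * ?K"
      by (rule intertwine_kron[OF W Ec[OF m] rEc[OF m] Fc[OF n] rFc[OF n] EW[OF m] FW[OF n]])
    \<comment> \<open>Since \<open>xi\<close> is the image of \<open>psi\<close>, the operators of
      the model act on it as those of the reference model act on \<open>psi\<close>, followed by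
      \<open>W\<close>. The splitting formula is then applied to the vector
      \<open>?K *\<^sub>v psi\<close>.\<close>
    have "kron_mat (E s s' g g') (F t t' h h') *\<^sub>v xi = W *\<^sub>v (?K *\<^sub>v psi)"
      unfolding Wpsi[symmetric]
      using assoc_mult_mat_vec[OF kron_mat_carrier[OF Ec[OF m] Fc[OF n]] W psi] assoc_mult_mat_vec[OF W Kc psi] EFW
      by simp
    moreover have "kron_mat (P i) (Q j) * W = W * kron_mat (mat_unit ?p 0 i) (mat_unit ?r 0 j)" if "i < ?p" "j < ?r" for i j
      by (rule intertwine_kron[OF W Pc mat_unit_carrier Qc mat_unit_carrier PW[OF that(1)] QW[OF that(2)]])
    ultimately show ?thesis
      using kron_stack_mult_vec[OF W mult_mat_vec_carrier[OF Kc psi] Pc Qc] by simp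
  qed
  ultimately show "\<exists>dAaux dBaux TA TB xiaux.
     isometry_mat (?p * dAaux) a TA \<and> isometry_mat (?r * dBaux) b TB \<and> unit_vec_in (dAaux * dBaux) xiaux \<and>
     (\<forall>s\<in>carrier G. \<forall>s'\<in>carrier G. \<forall>g\<in>carrier G. \<forall>g'\<in>carrier G.
      \<forall>t\<in>carrier G. \<forall>t'\<in>carrier G. \<forall>h\<in>carrier G. \<forall>h'\<in>carrier G.
        kron_mat TA TB *\<^sub>v (kron_mat (E s s' g g') (F t t' h h') *\<^sub>v xi)
        = reshuffle ?p ?r dAaux dBaux
            (kron_vec (kron_mat (rep_usom G ?p repr s s' g g') (rep_usom G ?r rho t t' h h') *\<^sub>v psi) xiaux))"
    by (intro exI[of _ a] exI[of _ b] exI[of _ ?TA] exI[of _ ?TB] exI[of _ "W *\<^sub>v ?e"] conjI ballI)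
qed


end
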